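(* Let $n=2r+1$ ($r\ge1$) and $1\le\ell\le r+1$. Let $\varphi:\mathcal B(\varpi_\ell)\simeq\mathcal B_0(\Lambda_\ell)_{\mathrm{aff}}\to\mathcal M(e^{\varpi_\ell}Y_{\ell,0}Y_{0,\ell}^{-1})$ be the isomorphism of $P$-crystals $z^sT\mapsto m_{T;-s}$, let $\mathrm{pr}_{\mathrm{aff}}$ be the affinized promotion operator of $\mathcal B(\varpi_\ell)\simeq\mathcal B_0(\Lambda_\ell)_{\mathrm{aff}}$, and let $\phi:\mathcal M(e^{\varpi_\ell}Y_{\ell,0}Y_{0,\ell}^{-1})\to\mathcal M(e^{\varpi_\ell}Y_{\ell,0}Y_{0,\ell}^{-1})$ be the map $\phi\big(\prod Y_{i,l}^{u_{i,l}}\big)=\prod Y_{i+1,l+1}^{u_{i,l}}$. Then $\varphi\circ\mathrm{pr}_{\mathrm{aff}}=\phi\circ\varphi$.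
   Context: Root data. $I=\{0,\dots,n\}$ identified with $\mathbb Z/(n+1)\mathbb Z$, $I_0=\{1,\dots,n\}$, $C=(C_{i,j})_{i,j\in I}$ the Cartan matrix of type $A_n^{(1)}$ ($C_{i,i}=2$, $C_{i,i\pm1}=-1$, other entries $0$), $\mathfrak h=\bigoplus_{i\in I}\mathbb Q h_i\oplus\mathbb Q d$; $\alpha_i(h_j)=C_{j,i}$, $\alpha_i(d)=\delta_{0,i}$, $\Lambda_i(h_j)=\delta_{i,j}$, $\Lambda_i(d)=0$; $\delta=\sum_i\alpha_i$, $P=\{\lambda\in\mathfrak h^*:\lambda(h_i)\in\mathbb Z\ \forall i\}$, $\varpi_\ell=\Lambda_\ell-\Lambda_0$. A $P$-crystal is a crystal over $\mathcal U_q(\widehat{sl}_{n+1})$. Monomial crystal. Consider monomials $m=e^{\omega(m)}\prod_{i\in I,l\in\mathbb Z}Y_{i,l}^{u_{i,l}(m)}$ with $u_{i,l}(m)\in\mathbb Z$ (finitely many non-zero), $\omega(m)\in P$, $\sum_l u_{i,l}(m)=\omega(m)(h_i)$. Put $A_{i,l}=e^{\alpha_i}Y_{i,l-1}Y_{i,l+1}Y_{i-1,l}^{-1}Y_{i+1,l}^{-1}$. Fix $s:I\to\{0,1\}$ with $s_i+s_j=1$ whenever $C_{i,j}=-1$ (chosen so that the monomials considered lie in $\mathcal M$); $\mathcal M$ is the group of monomials with $u_{i,l}(m)=0$ whenever $l\equiv s_i+1\bmod 2$. Set $\mathrm{wt}(m)=\omega(m)$, $\varphi_{i,L}(m)=\sum_{l\le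 L}u_{i,l}(m)$, $\varphi_i(m)=\max_L\varphi_{i,L}(m)$, $\varepsilon_{i,L}(m)=-\sum_{l\ge L}u_{i,l}(m)$, $\varepsilon_i(m)=\max_L\varepsilon_{i,L}(m)$, $p_i(m)=\max\{L:\varepsilon_{i,L}(m)=\varepsilon_i(m)\}$, $q_i(m)=\min\{L:\varphi_{i,L}(m)=\varphi_i(m)\}$; $\tilde e_i\cdot m=0$ if $\varepsilon_i(m)=0$, else $mA_{i,p_i(m)-1}$; $\tilde f_i\cdot m=0$ if $\varphi_i(m)=0$, else $mA_{i,q_i(m)+1}^{-1}$. $\mathcal M(m)$ is the connected subcrystal generated by $m$. Within $\mathcal M(e^{\varpi_\ell}Y_{\ell,0}Y_{0,\ell}^{-1})$ the factor $e^{\omega(m')}$ of an element $m'$ is determined by the exponents $u_{i,l}(m')$, so it is omitted from notation (in particular in the definition of $\phi$). Shift: $\tau_{2a,\alpha}(e^\lambda\prod Y_{i,l}^{u_{i,l}})=e^{\lambda+\alpha}\prod Y_{i,l+2a}^{u_{i,l}}$ for $a\in\mathbb Z$, $\alpha\in\mathbb Z\delta$. Monomials $m_{T;j}$. For $1\le k\le n+1$, $p\in\mathbb Z$ put $[k]_p=Y_{k-1,p+k}^{-1}Y_{k,p+k-1}$ with $Y_{n+1,p}:=Y_{0,p}$. For $T=(1\le i_1<\dots<i_\ell\le n+1)$ and $0\le j\le\ell-1$ put $m_{T;j}=\prod_{p=1}^j[i_p]_{n-\ell-2p+2j+2}\times\prod_{p=j+1}^\ell[i_p]_{\ell+1-2p+2j}$,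 and define $m_{T;j}$ for all $j\in\mathbb Z$ by $m_{T;j+\ell}=\tau_{n+1,-\ell\delta}(m_{T;j})$. These are the elements of $\mathcal M(e^{\varpi_\ell}Y_{\ell,0}Y_{0,\ell}^{-1})$. Crystals and promotion. $\mathcal B(\varpi_\ell)$ is the crystal of the level $0$ extremal weight $\mathcal U_q(\widehat{sl}_{n+1})$-module $V(\varpi_\ell)$. $\mathcal B_0(\Lambda_\ell)$ is the $\mathcal U_q(sl_{n+1})$-crystal of columns $T=(1\le i_1<\dots<i_\ell\le n+1)$; $w_i(T)$ is the number of entries $i$ in $T$; its promotion operator $\mathrm{pr}$ (Sch\"utzenberger jeu-de-taquin) replaces each entry $i$ by $i+1$, with $n+1$ replaced by $1$, and reorders. It becomes an affine crystal $\mathcal B_0(\Lambda_\ell)'_{\mathrm{aff}}$ with $\tilde e_0=\mathrm{pr}^{-1}\tilde e_1\mathrm{pr}$, $\tilde f_0=\mathrm{pr}^{-1}\tilde f_1\mathrm{pr}$, and its affinization $\mathcal B_0(\Lambda_\ell)_{\mathrm{aff}}$ has elements $z^sT$ ($s\in\mathbb Z$) with $\mathrm{wt}(z^sT)=\mathrm{wt}(T)+s\delta$, $\tilde e_i\cdot z^sT=z^{s+\delta_{i,0}}(\tilde e_i\cdot T)$, $\tilde f_i\cdot z^sT=z^{s-\delta_{i,0}}(\tilde f_i\cdot T)$. $\mathcal B(\varpi_\ell)$ and $\mathcal B_0(\Lambda_\ell)_{\mathrm{aff}}$ are isomorphic $P$-crystals and are identified. The affinized promotion operator is $\mathrm{pr}_{\mathrm{aff}}(z^sT)=z^{s-w_{n+1}(T)}\mathrm{pr}(T)$.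 *)

theory Defs
  imports Complex_Main "HOL-Library.FuncSet" "HOL-Library.Function_Algebras" "HOL-Library.Product_Plus"
begin

text \<open>
  The index set \<open>I = \<int>/(n+1)\<int>\<close> is represented by the natural numbers \<open>0, \<dots>, n\<close>.
  Indices are reduced modulo \<open>n + 1\<close> where they may leave this range; the index \<open>i - 1\<close> is
  written \<open>i + n\<close>.
\<close>

definition cartan :: "nat \<Rightarrow> nat \<Rightarrow> nat \<Rightarrow> int" where
  "cartan n i j =
     (if i = j then 2
      else if j = (i + 1) mod (n + 1) \<or> i = (j + 1) mod (n + 1) then -1
      else 0)"

text \<open>
  A linear form on \<open>\<hh> = \<Oplus>\<^sub>i \<rat> h\<^sub>i \<oplus> \<rat> d\<close> is given by its values on the basis. Forms vanish on the
  superfluous \<open>H i\<close>, \<open>i > n\<close>, so that equality of forms is equality of functions.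
\<close>

datatype cartan_basis = H nat | D

type_synonym weight = "cartan_basis \<Rightarrow> rat"

definition simple_root :: "nat \<Rightarrow> nat \<Rightarrow> weight" where
  "simple_root n i b =
     (case b of H j \<Rightarrow> if j \<le> n then of_int (cartan n j i) else 0
              | D \<Rightarrow> if i = 0 then 1 else 0)"

definition fund_weight :: "nat \<Rightarrow> nat \<Rightarrow> weight" where
  "fund_weight n i b = (case b of H j \<Rightarrow> if j = i mod (n + 1) then 1 else 0 | D \<Rightarrow> 0)"

definition delta :: "nat \<Rightarrow> weight" where
  "delta n = (\<Sum>i\<le>n. simple_root n i)"

definition scale :: "int \<Rightarrow> weight \<Rightarrow> weight" where
  "scale c w = (\<lambda>b. of_int c * w b)"

definition weight_lattice :: "nat \<Rightarrow> weight set" where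
  "weight_lattice n = {w. (\<forall>i\<le>n. w (H i) \<in> \<int>) \<and> (\<forall>i>n. w (H i) = 0)}"

definition level_zero_weight :: "nat \<Rightarrow> nat \<Rightarrow> weight" where
  "level_zero_weight n l = fund_weight n l - fund_weight n 0"


text \<open>The value \<open>0\<close> of a Kashiwara operator is represented by \<open>None\<close>.\<close>

record 'b crystal =
  carrier :: "'b set"
  wt :: "'b \<Rightarrow> weight"
  eps :: "nat \<Rightarrow> 'b \<Rightarrow> int"
  phi :: "nat \<Rightarrow> 'b \<Rightarrow> int"
  e_op :: "nat \<Rightarrow> 'b \<Rightarrow> 'b option"
  f_op :: "nat \<Rightarrow> 'b \<Rightarrow> 'b option"

definition crystal_iso :: "nat \<Rightarrow> 'a crystal \<Rightarrow> 'b crystal \<Rightarrow> ('a \<Rightarrow> 'b) \<Rightarrow> bool" where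
  "crystal_iso n A B h \<longleftrightarrow>
     bij_betw h (carrier A) (carrier B) \<and>
     (\<forall>x\<in>carrier A.
        wt B (h x) = wt A x \<and>
        (\<forall>i\<le>n. eps B i (h x) = eps A i x \<and>
               phi B i (h x) = phi A i x \<and>
               e_op B i (h x) = map_option h (e_op A i x) \<and>
               f_op B i (h x) = map_option h (f_op A i x)))"

inductive_set component :: "nat \<Rightarrow> 'b crystal \<Rightarrow> 'b \<Rightarrow> 'b set"
  for n :: nat and B :: "'b crystal" and m :: 'b where
  base: "m \<in> component n B m"
| e_step: "x \<in> component n B m \<Longrightarrow> i \<le> n \<Longrightarrow> e_op B i x = Some y \<Longrightarrow> y \<in> component n B m"
| f_step: "x \<in> component n B m \<Longrightarrow> i \<le> n \<Longrightarrow> f_op B i x = Some y \<Longrightarrow> y \<in> component n B m"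

definition generated_subcrystal :: "nat \<Rightarrow> 'b crystal \<Rightarrow> 'b \<Rightarrow> 'b crystal" where
  "generated_subcrystal n B m = B\<lparr>carrier := component n B m\<rparr>"


text \<open>
  A monomial \<open>e\<^sup>\<omega> \<Prod> Y\<^sub>i\<^sub>,\<^sub>k\<^bsup>u i k\<^esup>\<close> is the pair \<open>(\<omega>, u)\<close>. The group of monomials is therefore written
  additively: products of monomials are sums of pairs.
\<close>

type_synonym exponents = "nat \<Rightarrow> int \<Rightarrow> int"
type_synonym monomial = "weight \<times> exponents"

definition Y_exp :: "nat \<Rightarrow> nat \<Rightarrow> int \<Rightarrow> exponents" where
  "Y_exp n i k = (\<lambda>i' k'. if i' = i mod (n + 1) \<and> k' = k then 1 else 0)"

definition A_mono :: "nat \<Rightarrow> nat \<Rightarrow> int \<Rightarrow> monomial" where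
  "A_mono n i k =
     (simple_root n i,
      Y_exp n i (k - 1) + Y_exp n i (k + 1) - Y_exp n (i + n) k - Y_exp n (i + 1) k)"

text \<open>
  Sums over infinite sets of integers are restricted to the support of the summand, since
  \<open>sum\<close> is \<open>0\<close> on infinite sets.
\<close>

definition monomials :: "nat \<Rightarrow> (nat \<Rightarrow> nat) \<Rightarrow> monomial set" where
  "monomials n s =
     {(w, u). w \<in> weight_lattice n \<and>
        finite {(i, k). u i k \<noteq> 0} \<and>
        (\<forall>i>n. \<forall>k. u i k = 0) \<and>
        (\<forall>i\<le>n. of_int (\<Sum>k | u i k \<noteq> 0. u i k) = w (H i)) \<and>
        (\<forall>i\<le>n. \<forall>k. k mod 2 = (int (s i) + 1) mod 2 \<longrightarrow> u i k = 0)}"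

definition phi_upto :: "nat \<Rightarrow> int \<Rightarrow> monomial \<Rightarrow> int" where
  "phi_upto i L m = (\<Sum>k | k \<le> L \<and> snd m i k \<noteq> 0. snd m i k)"

definition eps_from :: "nat \<Rightarrow> int \<Rightarrow> monomial \<Rightarrow> int" where
  "eps_from i L m = - (\<Sum>k | k \<ge> L \<and> snd m i k \<noteq> 0. snd m i k)"

definition mono_phi :: "nat \<Rightarrow> monomial \<Rightarrow> int" where
  "mono_phi i m = Max (range (\<lambda>L. phi_upto i L m))"

definition mono_eps :: "nat \<Rightarrow> monomial \<Rightarrow> int" where
  "mono_eps i m = Max (range (\<lambda>L. eps_from i L m))"

text \<open>
  The sets defining \<open>p\<^sub>i\<close> and \<open>q\<^sub>i\<close> may be infinite to one side even when the extremum exists,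
  which rules out \<open>Max\<close> and \<open>Min\<close>.
\<close>

definition mono_p :: "nat \<Rightarrow> monomial \<Rightarrow> int" where
  "mono_p i m = (GREATEST L. eps_from i L m = mono_eps i m)"

definition mono_q :: "nat \<Rightarrow> monomial \<Rightarrow> int" where
  "mono_q i m = (LEAST L. phi_upto i L m = mono_phi i m)"

definition mono_e :: "nat \<Rightarrow> nat \<Rightarrow> monomial \<Rightarrow> monomial option" where
  "mono_e n i m =
     (if mono_eps i m = 0 then None else Some (m + A_mono n i (mono_p i m - 1)))"

definition mono_f :: "nat \<Rightarrow> nat \<Rightarrow> monomial \<Rightarrow> monomial option" where
  "mono_f n i m =
     (if mono_phi i m = 0 then None else Some (m - A_mono n i (mono_q i m + 1)))"

definition parity_function :: "nat \<Rightarrow> (nat \<Rightarrow> nat) \<Rightarrow> bool" where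
  "parity_function n s \<longleftrightarrow>
     (\<forall>i\<le>n. s i \<in> {0, 1}) \<and>
     (\<forall>i\<le>n. \<forall>j\<le>n. cartan n i j = -1 \<longrightarrow> s i + s j = 1)"

definition monomial_crystal :: "nat \<Rightarrow> (nat \<Rightarrow> nat) \<Rightarrow> monomial crystal" where
  "monomial_crystal n s =
     \<lparr>carrier = monomials n s, wt = fst, eps = mono_eps, phi = mono_phi,
      e_op = mono_e n, f_op = mono_f n\<rparr>"

definition start_mono :: "nat \<Rightarrow> nat \<Rightarrow> monomial" where
  "start_mono n l = (level_zero_weight n l, Y_exp n l 0 - Y_exp n 0 (int l))"

definition M_crystal :: "nat \<Rightarrow> (nat \<Rightarrow> nat) \<Rightarrow> nat \<Rightarrow> monomial crystal" where
  "M_crystal n s l = generated_subcrystal n (monomial_crystal n s) (start_mono n l)"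

text \<open>
  The map \<open>\<Prod> Y\<^sub>i\<^sub>,\<^sub>k\<^bsup>u i k\<^esup> \<mapsto> \<Prod> Y\<^sub>i\<^sub>+\<^sub>1\<^sub>,\<^sub>k\<^sub>+\<^sub>1\<^bsup>u i k\<^esup>\<close> is given on exponents only; the factor \<open>e\<^sup>\<omega>\<close> of the
  image is the one determined by the exponents within the connected subcrystal.
\<close>

definition rotate_exp :: "nat \<Rightarrow> exponents \<Rightarrow> exponents" where
  "rotate_exp n u = (\<lambda>i k. if i \<le> n then u ((i + n) mod (n + 1)) (k - 1) else 0)"

definition rotate_mono :: "nat \<Rightarrow> (nat \<Rightarrow> nat) \<Rightarrow> nat \<Rightarrow> monomial \<Rightarrow> monomial" where
  "rotate_mono n s l m =
     (THE m'. m' \<in> carrier (M_crystal n s l) \<and> snd m' = rotate_exp n (snd m))"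

definition tau :: "int \<Rightarrow> weight \<Rightarrow> monomial \<Rightarrow> monomial" where
  "tau a \<beta> m = (fst m + \<beta>, \<lambda>i k. snd m i (k - a))"


definition columns :: "nat \<Rightarrow> nat \<Rightarrow> nat list set" where
  "columns n l = {T. length T = l \<and> sorted_wrt (<) T \<and> set T \<subseteq> {1..n + 1}}"

definition promotion :: "nat \<Rightarrow> nat list \<Rightarrow> nat list" where
  "promotion n T = sort (map (\<lambda>k. if k = n + 1 then 1 else k + 1) T)"

definition col_e_fin :: "nat \<Rightarrow> nat list \<Rightarrow> nat list option" where
  "col_e_fin i T =
     (if i + 1 \<in> set T \<and> i \<notin> set T then Some (map (\<lambda>k. if k = i + 1 then i else k) T)
      else None)"

definition col_f_fin :: "nat \<Rightarrow> nat list \<Rightarrow> nat list option" where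
  "col_f_fin i T =
     (if i \<in> set T \<and> i + 1 \<notin> set T then Some (map (\<lambda>k. if k = i then i + 1 else k) T)
      else None)"

definition col_e :: "nat \<Rightarrow> nat \<Rightarrow> nat \<Rightarrow> nat list \<Rightarrow> nat list option" where
  "col_e n l i T =
     (if i = 0
      then map_option (inv_into (columns n l) (promotion n)) (col_e_fin 1 (promotion n T))
      else col_e_fin i T)"

definition col_f :: "nat \<Rightarrow> nat \<Rightarrow> nat \<Rightarrow> nat list \<Rightarrow> nat list option" where
  "col_f n l i T =
     (if i = 0
      then map_option (inv_into (columns n l) (promotion n)) (col_f_fin 1 (promotion n T))
      else col_f_fin i T)"

text \<open>
  The \<open>sl\<^sub>n\<^sub>+\<^sub>1\<close>-weight of a column as a level zero affine weight vanishing on \<open>d\<close>: the entry \<open>k\<close>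
  contributes \<open>\<Lambda>\<^sub>k - \<Lambda>\<^sub>k\<^sub>-\<^sub>1\<close>, where \<open>\<Lambda>\<^sub>n\<^sub>+\<^sub>1 = \<Lambda>\<^sub>0\<close>.
\<close>

definition col_wt :: "nat \<Rightarrow> nat list \<Rightarrow> weight" where
  "col_wt n T = (\<Sum>k\<leftarrow>T. fund_weight n k - fund_weight n (k - 1))"

definition max_steps :: "('b \<Rightarrow> 'b option) \<Rightarrow> 'b \<Rightarrow> nat" where
  "max_steps g x = (GREATEST k. ((\<lambda>y. Option.bind y g) ^^ k) (Some x) \<noteq> None)"

text \<open>
  The affinization of the crystal of columns; the pair \<open>(c, T)\<close> stands for \<open>z\<^sup>c T\<close>. This is also
  the crystal of the extremal weight module of weight \<open>\<Lambda>\<^sub>l - \<Lambda>\<^sub>0\<close>.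
\<close>

definition aff_crystal :: "nat \<Rightarrow> nat \<Rightarrow> (int \<times> nat list) crystal" where
  "aff_crystal n l =
     \<lparr>carrier = UNIV \<times> columns n l,
      wt = (\<lambda>(c, T). col_wt n T + scale c (delta n)),
      eps = (\<lambda>i (c, T). int (max_steps (col_e n l i) T)),
      phi = (\<lambda>i (c, T). int (max_steps (col_f n l i) T)),
      e_op = (\<lambda>i (c, T). map_option (Pair (if i = 0 then c + 1 else c)) (col_e n l i T)),
      f_op = (\<lambda>i (c, T). map_option (Pair (if i = 0 then c - 1 else c)) (col_f n l i T))\<rparr>"

definition aff_promotion :: "nat \<Rightarrow> int \<times> nat list \<Rightarrow> int \<times> nat list" where
  "aff_promotion n = (\<lambda>(c, T). (c - int (count_list T (n + 1)), promotion n T))"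


definition box_exp :: "nat \<Rightarrow> nat \<Rightarrow> int \<Rightarrow> exponents" where
  "box_exp n k p = Y_exp n k (p + int k - 1) - Y_exp n (k - 1) (p + int k)"

text \<open>
  The monomial \<open>m\<^sub>T\<^sub>;\<^sub>j\<close> for \<open>0 \<le> j < l\<close>. Its factor \<open>e\<^sup>\<omega>\<close> is not visible in the product of boxes; it
  is \<open>\<omega> = wt(T) - j\<delta>\<close>, the weight of \<open>z\<^bsup>-j\<^esup> T\<close>. The entry \<open>i\<^sub>p\<close> of \<open>T\<close> is \<open>T ! (p - 1)\<close>.
\<close>

definition col_mono_base :: "nat \<Rightarrow> nat \<Rightarrow> nat list \<Rightarrow> nat \<Rightarrow> monomial" where
  "col_mono_base n l T j =
     (col_wt n T - scale (int j) (delta n),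
      (\<Sum>p = 1..j. box_exp n (T ! (p - 1)) (int n - int l - 2 * int p + 2 * int j + 2)) +
      (\<Sum>p = j + 1..l. box_exp n (T ! (p - 1)) (int l + 1 - 2 * int p + 2 * int j)))"

text \<open>The extension to all integers \<open>j\<close> by \<open>m\<^sub>T\<^sub>;\<^sub>j\<^sub>+\<^sub>l = \<tau>\<^bsub>n+1,-l\<delta>\<^esub> (m\<^sub>T\<^sub>;\<^sub>j)\<close>.\<close>

definition col_mono :: "nat \<Rightarrow> nat \<Rightarrow> nat list \<Rightarrow> int \<Rightarrow> monomial" where
  "col_mono n l T j =
     tau (int (n + 1) * (j div int l)) (scale (- int l * (j div int l)) (delta n))
       (col_mono_base n l T (nat (j mod int l)))"

definition aff_to_mono :: "nat \<Rightarrow> nat \<Rightarrow> int \<times> nat list \<Rightarrow> monomial" where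
  "aff_to_mono n l = (\<lambda>(c, T). col_mono n l T (- c))"

end

theory Submission
  imports Defs "HOL-Library.Multiset"
begin

text \<open>
  Write \<open>N = n + 1\<close>. The idea is to replace an element \<open>z\<^sup>c T\<close> of the affine crystal by a
  strictly increasing sequence \<open>K\<close> of integers with \<open>K (p + l) = K p + N\<close>: continue the entries of
  \<open>T\<close> periodically by this rule and slide the sequence by \<open>c\<close> positions. All the data of the
  theorem have uniform descriptions in terms of \<open>K\<close>.

  \<^item> The monomial \<open>m\<^sub>T\<^sub>;\<^sub>-\<^sub>c\<close> is \<open>\<Prod> [K p]\<^bsub>l - 1 - 2 p\<^esub>\<close> over \<open>0 \<le> p < l\<close>
    (\<open>snd_aff_to_mono\<close>); the two products and the shift \<open>\<tau>\<close> in its definition come from the place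
    where the window \<open>0 \<le> p < l\<close> cuts the sequence.
  \<^item> The affinized promotion is \<open>K \<mapsto> K + 1\<close> (\<open>window_aff_promotion\<close>), while adding one to \<open>v\<close> in a
    box \<open>[v]\<^sub>a\<close> is the map \<open>Y\<^sub>i\<^sub>,\<^sub>k \<mapsto> Y\<^sub>i\<^sub>+\<^sub>1\<^sub>,\<^sub>k\<^sub>+\<^sub>1\<close> (\<open>box_rotate\<close>). This is the intertwining
    relation.
  \<^item> For every \<open>i\<close>, including \<open>0\<close>, the operator \<open>f\<^sub>i\<close> is defined if \<open>i\<close> occurs among the values of
    \<open>K\<close> and \<open>i + 1\<close> does not, and it raises the values congruent to \<open>i\<close> by one (\<open>window_f_op\<close>).

  That the map to monomials is a morphism of crystals is seen row by row. Row \<open>i\<close> of the exponents has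
  a positive factor if \<open>i\<close> occurs and a negative one if \<open>i + 1\<close> occurs. If there is one factor, the
  operator on monomials moves the corresponding box. If there are both, neither operator acts on the
  column, and on the monomial this requires that the negative factor does not follow the positive
  one; this is the role of \<open>2 l \<le> N\<close> (\<open>neighbours_positions\<close>).

  The morphism is injective, even on exponents: \<open>\<phi>\<^sub>i - \<epsilon>\<^sub>i\<close> determines the column, and the second
  moment \<open>\<Sum> k\<^sup>2 u\<^sub>i\<^sub>,\<^sub>k\<close> determines the sum of the window and with it the power of \<open>z\<close>
  (\<open>to_mono_exponents_inj\<close>). Its image is the component of the generating monomial, which is the window
  \<open>1, \<dots>, l\<close>, because any window can be moved to this one by steps that decrease the distance
  \<open>\<Sum> \<bar>K p - (p + 1)\<bar>\<close> (\<open>to_mono_in_component\<close>).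
\<close>

lemma sum_apply: "(\<Sum>p\<in>A. f p) x = (\<Sum>p\<in>A. f p x)"
  for f :: "'a \<Rightarrow> 'b \<Rightarrow> 'c::comm_monoid_add"
  by (induction A rule: infinite_finite_induct) auto

section \<open>Kashiwara operators on a row with at most one factor of each sign\<close>

lemma phi_upto_two_factors:
  assumes "snd m i = (\<lambda>k. x * of_bool (k = a) - y * of_bool (k = b))"
  shows "phi_upto i L m = x * of_bool (a \<le> L) - y * of_bool (b \<le> L)"
proof -
  have "phi_upto i L m = (\<Sum>k\<in>{a, b} \<inter> {..L}. snd m i k)"
    unfolding phi_upto_def by (rule sum.mono_neutral_left) (auto simp: assms)
  also have "\<dots> = x * of_bool (a \<le> L) - y * of_bool (b \<le> L)"
    by (cases "a = b"; cases "a \<le> L"; cases "b \<le> L") (auto simp: assms Int_insert_left)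
  finally show ?thesis .
qed

lemma eps_from_two_factors:
  assumes "snd m i = (\<lambda>k. x * of_bool (k = a) - y * of_bool (k = b))"
  shows "eps_from i L m = y * of_bool (L \<le> b) - x * of_bool (L \<le> a)"
proof -
  have "eps_from i L m = - (\<Sum>k\<in>{a, b} \<inter> {L..}. snd m i k)"
    unfolding eps_from_def
    by (intro arg_cong[of _ _ uminus] sum.mono_neutral_left) (auto simp: assms)
  also have "\<dots> = y * of_bool (L \<le> b) - x * of_bool (L \<le> a)"
    by (cases "a = b"; cases "L \<le> a"; cases "L \<le> b") (auto simp: assms Int_insert_left)
  finally show ?thesis .
qed

text \<open>
  Partial sums of such a row lie between \<open>-1\<close> and \<open>1\<close>, so the range of \<open>\<phi>\<^sub>i\<^sub>,\<^sub>L\<close> or \<open>\<epsilon>\<^sub>i\<^sub>,\<^sub>L\<close> is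
  finite and its maximum can be read off from a single \<open>L\<close>.
\<close>

lemma Max_range_bounded:
  fixes f :: "int \<Rightarrow> int"
  assumes "range f \<subseteq> {x. -1 \<le> x \<and> x \<le> M}" "f a = M"
  shows "Max (range f) = M"
proof (rule Max_eqI)
  have "range f \<subseteq> {-1..M}" using assms by auto
  then show "finite (range f)" by (rule finite_subset) simp
qed (use assms in auto)

lemma
  assumes row: "snd m i = (\<lambda>k. of_bool (k = a))"
  shows mono_phi_single_pos: "mono_phi i m = 1"
    and mono_eps_single_pos: "mono_eps i m = 0"
    and mono_q_single_pos: "mono_q i m = a"
proof -
  have row': "snd m i = (\<lambda>k. 1 * of_bool (k = a) - 0 * of_bool (k = a))"
    using row by simp
  have phi: "phi_upto i L m = of_bool (a \<le> L)" and eps: "eps_from i L m = - of_bool (L \<le> a)" for L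
    by (simp_all add: phi_upto_two_factors[OF row'] eps_from_two_factors[OF row'])
  show \<phi>: "mono_phi i m = 1"
    unfolding mono_phi_def phi by (rule Max_range_bounded[of _ _ a]) auto
  show "mono_eps i m = 0"
    unfolding mono_eps_def eps by (rule Max_range_bounded[of _ _ "a + 1"]) auto
  show "mono_q i m = a"
    unfolding mono_q_def phi \<phi> by (rule Least_equality) auto
qed

lemma
  assumes row: "snd m i = (\<lambda>k. - of_bool (k = b))"
  shows mono_phi_single_neg: "mono_phi i m = 0"
    and mono_eps_single_neg: "mono_eps i m = 1"
    and mono_p_single_neg: "mono_p i m = b"
proof -
  have row': "snd m i = (\<lambda>k. 0 * of_bool (k = b) - 1 * of_bool (k = b))"
    using row by simp
  have phi: "phi_upto i L m = - of_bool (b \<le> L)" and eps: "eps_from i L m = of_bool (L \<le> b)" for L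
    by (simp_all add: phi_upto_two_factors[OF row'] eps_from_two_factors[OF row'])
  show "mono_phi i m = 0"
    unfolding mono_phi_def phi by (rule Max_range_bounded[of _ _ "b - 1"]) auto
  show \<epsilon>: "mono_eps i m = 1"
    unfolding mono_eps_def eps by (rule Max_range_bounded[of _ _ b]) auto
  show "mono_p i m = b"
    unfolding mono_p_def eps \<epsilon> by (rule Greatest_equality) auto
qed

text \<open>
  When the negative factor does not come after the positive one, no partial sum
  \<open>\<phi>\<^sub>i\<^sub>,\<^sub>L\<close> or \<open>\<epsilon>\<^sub>i\<^sub>,\<^sub>L\<close> is ever positive, so both operators vanish. With the opposite order both would act, which is not what the
  crystal of columns does when \<open>i\<close> and \<open>i + 1\<close> both occur. This is where the order of the factors
  of the monomials of columns matters.
\<close>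

lemma
  assumes row: "snd m i = (\<lambda>k. of_bool (k = a) - of_bool (k = b))" and "b \<le> a"
  shows mono_phi_neg_before_pos: "mono_phi i m = 0"
    and mono_eps_neg_before_pos: "mono_eps i m = 0"
proof -
  have row': "snd m i = (\<lambda>k. 1 * of_bool (k = a) - 1 * of_bool (k = b))"
    using row by simp
  have phi: "phi_upto i L m = of_bool (a \<le> L) - of_bool (b \<le> L)"
    and eps: "eps_from i L m = of_bool (L \<le> b) - of_bool (L \<le> a)" for L
    by (simp_all add: phi_upto_two_factors[OF row'] eps_from_two_factors[OF row'])
  show "mono_phi i m = 0"
    unfolding mono_phi_def phi by (rule Max_range_bounded[of _ _ "b - 1"]) (use \<open>b \<le> a\<close> in auto)
  show "mono_eps i m = 0"
    unfolding mono_eps_def eps by (rule Max_range_bounded[of _ _ "a + 1"]) (use \<open>b \<le> a\<close> in auto)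
qed

lemma
  assumes row: "snd m i = (\<lambda>k. 0)"
  shows mono_phi_empty_row: "mono_phi i m = 0" and mono_eps_empty_row: "mono_eps i m = 0"
  using mono_phi_neg_before_pos[of m i 0 0] mono_eps_neg_before_pos[of m i 0 0] row by simp_all

section \<open>Boxes and windows\<close>

text \<open>
  The factor \<open>[v]\<^sub>a\<close> for any integer \<open>v\<close>: the first index of \<open>Y\<close> only depends on \<open>v\<close> modulo
  \<open>n + 1\<close>, whereas the second one remembers \<open>v\<close> itself. Replacing \<open>v\<close> by \<open>v + n + 1\<close> is thus a
  shift by \<open>n + 1\<close> of the second indices.
\<close>

definition box :: "nat \<Rightarrow> int \<Rightarrow> int \<Rightarrow> exponents" where
  "box n v a = (\<lambda>i k. of_bool (int i = v mod int (n + 1) \<and> k = a + v - 1)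
                   - of_bool (int i = (v - 1) mod int (n + 1) \<and> k = a + v))"

lemma Y_exp_apply: "Y_exp n j k i k' = of_bool (int i = int j mod int (n + 1) \<and> k' = k)"
proof -
  have "int j mod int (n + 1) = int (j mod (n + 1))" by (rule zmod_int[symmetric])
  then show ?thesis by (simp add: Y_exp_def del: of_nat_add of_nat_Suc)
qed

lemma box_of_nat:
  assumes "1 \<le> j" shows "box n (int j) a = box_exp n j a"
proof -
  have "int (j - 1) = int j - 1" using assms by simp
  then show ?thesis
    by (intro ext) (simp add: box_def box_exp_def Y_exp_apply del: of_nat_diff)
qed

lemma box_shift: "box n (v + int (n + 1) * d) a i k = box n v a i (k - int (n + 1) * d)"
proof -
  have "(v + int (n + 1) * d - 1) mod int (n + 1) = (v - 1) mod int (n + 1)"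
    by (metis add_diff_eq diff_add_eq mod_mult_self2)
  then show ?thesis by (auto simp: box_def simp del: of_nat_Suc of_nat_add)
qed

text \<open>
  Raising an entry by one is multiplication by \<open>A\<^sub>i\<^bsup>-1\<^esup>\<close>: this is the computation that makes
  columns and monomials move together.
\<close>

lemma box_Suc:
  assumes "int i = v mod int (n + 1)"
  shows "box n (v + 1) a = box n v a - snd (A_mono n i (a + v))"
proof -
  have "int (i + 1) mod int (n + 1) = (v + 1) mod int (n + 1)"
    by (metis assms mod_add_left_eq of_nat_1 of_nat_add)
  moreover have "int (i + n) mod int (n + 1) = (v - 1) mod int (n + 1)"
  proof -
    have "int (i + n) = v mod int (n + 1) - 1 + int (n + 1)" using assms by simp
    then show ?thesis by (metis mod_add_self2 mod_diff_left_eq)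
  qed
  moreover have "int i mod int (n + 1) = v mod int (n + 1)" using assms by simp
  ultimately show ?thesis
    by (intro ext) (auto simp add: box_def A_mono_def Y_exp_apply  simp del: of_nat_Suc of_nat_add)
qed

definition window_exp :: "nat \<Rightarrow> nat \<Rightarrow> (int \<Rightarrow> int) \<Rightarrow> exponents" where
  "window_exp n l K = (\<Sum>p = 0..<int l. box n (K p) (int l - 1 - 2 * p))"

text \<open>
  The entries of a column are continued to all integers \<open>p\<close> by \<open>i\<^sub>p\<^sub>+\<^sub>l = i\<^sub>p + n + 1\<close>, with positions
  counted from \<open>0\<close>; the exponent of \<open>z\<close> slides the resulting sequence, so that the \<open>l\<close> entries at
  positions \<open>0, \<dots>, l - 1\<close> show the sequence through a window.
\<close>

definition window :: "nat \<Rightarrow> nat \<Rightarrow> int \<times> nat list \<Rightarrow> int \<Rightarrow> int" where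
  "window n l x p = int (snd x ! nat ((p - fst x) mod int l)) + int (n + 1) * ((p - fst x) div int l)"

text \<open>
  The two products in the definition of \<open>m\<^sub>T\<^sub>;\<^sub>j\<close> are the two parts of one window: the last \<open>l - j\<close>
  entries of \<open>T\<close> come first, and the first \<open>j\<close> entries follow, raised by \<open>n + 1\<close>. This raise
  accounts for the different lower indices of the boxes in the first product.
\<close>

lemma snd_col_mono_base:
  assumes "set T \<subseteq> {1..n + 1}" "length T = l" "j < l"
  shows "snd (col_mono_base n l T j) = window_exp n l (window n l (- int j, T))"
proof -
  let ?N = "int (n + 1)"
  define F where "F = (\<lambda>p. box n (window n l (- int j, T) p) (int l - 1 - 2 * p))"
  have pos: "1 \<le> T ! m" if "m < l" for m
    using assms that nth_mem[of m T] by force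
  have first: "(\<Sum>p = 1..j. box_exp n (T ! (p - 1)) (int n - int l - 2 * int p + 2 * int j + 2))
      = (\<Sum>p = int l - int j..<int l. F p)"
  proof (rule sum.reindex_bij_witness[of _ "\<lambda>p. nat (p + int j - int l + 1)" "\<lambda>p. int p - 1 - int j + int l"], goal_cases)
    case (4 p)
    then show ?case using assms by auto
  next
    case (5 p)
    then have p: "1 \<le> p" "p \<le> j" by auto
    \<comment> \<open>these positions lie in the second copy of the column, whence the raise by \<open>n + 1\<close>\<close>
    have md: "(int (p - 1) + int l) div int l = 1" "(int (p - 1) + int l) mod int l = int (p - 1)"
      using p assms by auto
    have eq: "int p - 1 - int j + int l + int j = int (p - 1) + int l" using p by simp
    have "window n l (- int j, T) (int p - 1 - int j + int l) = int (T ! (p - 1)) + ?N * 1"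
      unfolding window_def fst_conv snd_conv diff_minus_eq_add eq md by simp
    then have "F (int p - 1 - int j + int l) = 
       box n (int (T ! (p - 1)) + ?N * 1) (int l - 1 - 2 * (int p - 1 - int j + int l))"
      unfolding F_def by simp
    also have "\<dots> = box n (int (T ! (p - 1))) (int n - int l - 2 * int p + 2 * int j + 2)"
      by (intro ext, unfold box_shift) (auto simp: box_def)
    finally show ?case using box_of_nat pos p assms by simp
  qed (use assms in auto)
  have second: "(\<Sum>p = j + 1..l. box_exp n (T ! (p - 1)) (int l + 1 - 2 * int p + 2 * int j))
      = (\<Sum>p = 0..<int l - int j. F p)"
  proof (rule sum.reindex_bij_witness[of _ "\<lambda>p. nat (p + int j + 1)" "\<lambda>p. int p - 1 - int j"], goal_cases)
    case (5 p)
    then have p: "1 \<le> p" "p \<le> l" by auto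
    have md: "(int (p - 1)) div int l = 0" "(int (p - 1)) mod int l = int (p - 1)"
      using p assms by auto
    have eq: "int p - 1 - int j + int j = int (p - 1)" using p by simp
    have "window n l (- int j, T) (int p - 1 - int j) = int (T ! (p - 1))"
      unfolding window_def fst_conv snd_conv diff_minus_eq_add eq md by simp
    then have "F (int p - 1 - int j) = 
       box n (int (T ! (p - 1))) (int l + 1 - 2 * int p + 2 * int j)"
      unfolding F_def by (simp add: algebra_simps)
    then show ?case using box_of_nat pos p by simp
  qed (use assms in auto)
  have "window_exp n l (window n l (- int j, T)) = (\<Sum>p = 0..<int l. F p)"
    by (simp add: window_exp_def F_def)
  also have "\<dots> = (\<Sum>p = 0..<int l - int j. F p) + (\<Sum>p = int l - int j..<int l. F p)"
    using assms by (subst sum.union_disjoint[symmetric]) (auto intro!: sum.cong)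
  finally show ?thesis
    unfolding col_mono_base_def snd_conv first second by (simp add: add.commute)
qed

lemma window_shift: "0 < l \<Longrightarrow> window n l (c - int l * d, T) p = window n l (c, T) p + int (n + 1) * d"
proof -
  assume "0 < l"
  have "p - (c - int l * d) = (p - c) + int l * d" by simp
  moreover have "(p - c + int l * d) div int l = (p - c) div int l + d"
    using \<open>0 < l\<close> by simp
  ultimately show ?thesis
    unfolding window_def fst_conv snd_conv by (simp only: mod_mult_self2 distrib_left add.assoc)
qed

lemma window_exp_shift:
  "window_exp n l (\<lambda>p. K p + int (n + 1) * d) i k = window_exp n l K i (k - int (n + 1) * d)"
  unfolding window_exp_def sum_apply by (simp only: box_shift)

text \<open>
  The shift \<open>\<tau>\<close> in the definition of \<open>m\<^sub>T\<^sub>;\<^sub>j\<^sub>+\<^sub>l\<close> is the raise of the whole window by \<open>n + 1\<close>, so the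
  formula for \<open>0 \<le> j < l\<close> persists for all \<open>j\<close>.
\<close>

lemma snd_aff_to_mono:
  assumes "snd x \<in> columns n l" "0 < l"
  shows "snd (aff_to_mono n l x) = window_exp n l (window n l x)"
proof -
  obtain c T where x: "x = (c, T)" by (cases x)
  define j where "j = nat ((- c) mod int l)"
  define d where "d = (- c) div int l"
  have j: "j < l" using \<open>0 < l\<close> by (simp add: j_def nat_less_iff)
  have "- c = int j + int l * d"
    using \<open>0 < l\<close> by (simp add: j_def d_def)
  then have c: "- int j - int l * d = c" by simp
  have "snd (aff_to_mono n l x) i k = window_exp n l (window n l x) i k" for i k
  proof -
    have "snd (aff_to_mono n l x) i k = snd (col_mono_base n l T j) i (k - int (n + 1) * d)"
      by (simp add: aff_to_mono_def col_mono_def tau_def x j_def d_def)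
    also have "\<dots> = window_exp n l (\<lambda>p. window n l (- int j, T) p + int (n + 1) * d) i k"
      using assms j unfolding x columns_def by (simp only: snd_col_mono_base window_exp_shift mem_Collect_eq snd_conv)
    also have "(\<lambda>p. window n l (- int j, T) p + int (n + 1) * d) = window n l x"
      using window_shift[OF \<open>0 < l\<close>, of n "- int j" d T] by (simp add: c x fun_eq_iff)
    finally show ?thesis .
  qed
  then show ?thesis by (intro ext)
qed

lemma fst_aff_to_mono:
  assumes "0 < l"
  shows "fst (aff_to_mono n l (c, T)) = col_wt n T + scale c (delta n)"
proof
  fix b
  define j where "j = nat ((- c) mod int l)"
  define d where "d = (- c) div int l"
  have "int j = - c - int l * d"
    unfolding j_def d_def using pos_mod_sign[of "int l" "- c"] assms
    by (simp only: int_nat_eq of_nat_0_less_iff if_True minus_mult_div_eq_mod)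
  then have j: "rat_of_int (int j) = - of_int c - of_int (int l) * of_int d"
    by (metis of_int_diff of_int_minus of_int_mult)
  have "fst (aff_to_mono n l (c, T)) b
      = col_wt n T b - rat_of_int (int j) * delta n b + of_int (- int l * d) * delta n b"
    by (simp add: aff_to_mono_def col_mono_def tau_def col_mono_base_def scale_def j_def d_def)
  also have "\<dots> = (col_wt n T + scale c (delta n)) b"
    unfolding j by (simp add: scale_def algebra_simps)
  finally show "fst (aff_to_mono n l (c, T)) b = (col_wt n T + scale c (delta n)) b" .
qed

lemma in_columns_iff:
  "T \<in> columns n l \<longleftrightarrow> length T = l \<and> sorted_wrt (<) T \<and> (\<forall>k\<in>set T. 1 \<le> k \<and> k \<le> n + 1)"
  by (auto simp: columns_def)

lemma columns_nth: "T \<in> columns n l \<Longrightarrow> m < l \<Longrightarrow> 1 \<le> T ! m \<and> T ! m \<le> n + 1"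
  by (auto simp: in_columns_iff)

lemma columns_eqI: "T \<in> columns n l \<Longrightarrow> U \<in> columns n l \<Longrightarrow> set T = set U \<Longrightarrow> T = U"
  by (auto simp: in_columns_iff intro: strict_sorted_equal)

text \<open>
  The effect of \<open>f\<^sub>i\<close> on the entries of a window, uniform in \<open>i\<close>.
\<close>

definition raise :: "nat \<Rightarrow> int \<Rightarrow> int \<Rightarrow> int" where
  "raise n i v = (if v mod int (n + 1) = i mod int (n + 1) then v + 1 else v)"

lemma div_mod_add_one_less:
  fixes t l :: int
  assumes "0 < l" "t mod l + 1 < l"
  shows "(t + 1) mod l = t mod l + 1" "(t + 1) div l = t div l"
proof -
  have eq: "t + 1 = l * (t div l) + (t mod l + 1)" using mult_div_mod_eq[of l t] by linarith
  have "0 \<le> t mod l + 1" using pos_mod_sign[OF \<open>0 < l\<close>, of t] by linarith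
  then show "(t + 1) mod l = t mod l + 1" "(t + 1) div l = t div l"
    using int_mod_pos_eq[OF eq] int_div_pos_eq[OF eq] assms by blast+
qed

lemma div_mod_add_one_eq:
  fixes t l :: int
  assumes "0 < l" "t mod l + 1 = l"
  shows "(t + 1) mod l = 0" "(t + 1) div l = t div l + 1"
proof -
  have "t + 1 = l * (t div l) + l" using mult_div_mod_eq[of l t] assms by linarith
  then have eq: "t + 1 = l * (t div l + 1) + 0" by (simp only: distrib_left mult_1_right add_0_right)
  show "(t + 1) mod l = 0" "(t + 1) div l = t div l + 1"
    using int_mod_pos_eq[OF eq] int_div_pos_eq[OF eq] assms by simp_all
qed

text \<open>
  Everything uses two consequences of \<open>n = 2r + 1\<close>, \<open>r \<ge> 1\<close> and \<open>l \<le> r + 1\<close>. The bound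
  \<open>2l \<le> n + 1\<close> puts the factors of each row in the right order and leaves gaps in every
  window; \<open>n \<ge> 2\<close> makes the neighbours \<open>i - 1\<close> and \<open>i + 1\<close> of a node distinct.
\<close>

locale column_shape =
  fixes n l :: nat
  assumes l_pos: "0 < l" and l_le: "2 * l \<le> n + 1" and n_ge: "2 \<le> n"
begin

abbreviation "affine_columns \<equiv> UNIV \<times> columns n l"
abbreviation "K \<equiv> window n l"

lemma window_periodic: "K x (p + int l) = K x p + int (n + 1)"
proof -
  have eq: "p + int l - fst x = (p - fst x) + int l" by simp
  have "(p + int l - fst x) div int l = (p - fst x) div int l + 1"
    unfolding eq using l_pos by simp
  moreover have "(p + int l - fst x) mod int l = (p - fst x) mod int l"
    unfolding eq by simp
  ultimately show ?thesis
    unfolding window_def by (simp only: distrib_left mult_1_right)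
qed

lemma window_less_Suc:
  assumes "x \<in> affine_columns" shows "K x p < K x (p + 1)"
proof -
  define t where "t = p - fst x"
  define m where "m = t mod int l"
  have m: "0 \<le> m" "m < int l" using l_pos by (auto simp: m_def)
  have T: "snd x \<in> columns n l" using assms by auto
  have eq: "p + 1 - fst x = t + 1" by (simp add: t_def)
  show ?thesis
  proof (cases "m + 1 < int l")
    case True
    have dm: "(t + 1) mod int l = m + 1" "(t + 1) div int l = t div int l"
      using True div_mod_add_one_less[of "int l" t] l_pos by (simp_all add: m_def)
    have "snd x ! nat m < snd x ! nat (m + 1)"
      using T True m by (intro sorted_wrt_nth_less[of "(<)"]) (auto simp: in_columns_iff nat_less_iff)
    then show ?thesis unfolding window_def eq dm using m_def t_def by simp
  next
    case False
    then have ml: "m + 1 = int l" using m by simp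
    have dm: "(t + 1) mod int l = 0" "(t + 1) div int l = t div int l + 1"
      using ml div_mod_add_one_eq[of "int l" t] l_pos by (simp_all add: m_def)
    have "snd x ! nat m \<le> n + 1" "1 \<le> snd x ! 0"
      using columns_nth[OF T, of "nat m"] columns_nth[OF T, of 0] m l_pos by auto
    then show ?thesis unfolding window_def eq dm t_def[symmetric] m_def[symmetric] distrib_left
      by simp
  qed
qed

lemma window_less:
  assumes "x \<in> affine_columns" "p < q" shows "K x p < K x q"
  using assms(2)
proof (induction q rule: int_gr_induct)
  case base
  show ?case using window_less_Suc assms(1) by blast
next
  case (step i)
  then show ?case using window_less_Suc[OF assms(1), of i] by simp
qed

lemma window_less_iff: "x \<in> affine_columns \<Longrightarrow> K x p < K x q \<longleftrightarrow> p < q"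
  using window_less by (metis less_asym linorder_less_linear)

text \<open>
  As a set, the sequence consists of the integers congruent to an entry of the column. Membership of
  \<open>int i\<close> in this range therefore says that \<open>i\<close> occurs in the column, in a form that treats
  \<open>0\<close> and \<open>n + 1\<close> alike.
\<close>

lemma range_window:
  assumes "x \<in> affine_columns"
  shows "range (K x) = {v. \<exists>t\<in>set (snd x). v mod int (n + 1) = int t mod int (n + 1)}"
proof (intro set_eqI iffI)
  fix v assume "v \<in> range (K x)"
  then obtain p where p: "v = K x p" by auto
  have "nat ((p - fst x) mod int l) < length (snd x)"
    using assms l_pos by (auto simp: in_columns_iff nat_less_iff)
  then have "snd x ! nat ((p - fst x) mod int l) \<in> set (snd x)" by simp
  then show "v \<in> {v. \<exists>t\<in>set (snd x). v mod int (n + 1) = int t mod int (n + 1)}"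
    unfolding p window_def mem_Collect_eq by (intro bexI) (auto simp only: mod_mult_self2)
next
  fix v assume "v \<in> {v. \<exists>t\<in>set (snd x). v mod int (n + 1) = int t mod int (n + 1)}"
  then obtain m where m: "m < l" "v mod int (n + 1) = int (snd x ! m) mod int (n + 1)"
    using assms by (auto simp: in_set_conv_nth in_columns_iff)
  then obtain d where d: "v = int (snd x ! m) + int (n + 1) * d"
    by (metis mod_eqE mult.commute add.commute diff_add_cancel diff_eq_eq)
  have "K x (fst x + int m + int l * d) = v"
    using m l_pos unfolding window_def d by (simp add: add.commute[of "fst x"] add.assoc)
  then show "v \<in> range (K x)" by blast
qed

lemma window_index:
  assumes "v \<in> range (K x)"
  obtains p where "0 \<le> p" "p < int l" "K x p mod int (n + 1) = v mod int (n + 1)"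
proof -
  have shift: "K x (p + int l * d) = K x p + int (n + 1) * d" for p d
    using window_shift[OF l_pos, of n "fst x" d "snd x" p] 
    by (simp add: window_def algebra_simps)
  obtain p where "v = K x p" using assms by auto
  also have "p = p mod int l + int l * (p div int l)" by simp
  finally have "K x (p mod int l) mod int (n + 1) = v mod int (n + 1)"
    by (metis mod_mult_self2 shift)
  then show ?thesis using that[of "p mod int l"] l_pos by simp
qed

text \<open>
  The entries at positions \<open>0, \<dots>, l - 1\<close> increase strictly and stay below the first one plus
  \<open>n + 1\<close>.
\<close>

lemma window_inj_mod:
  assumes "x \<in> affine_columns" "0 \<le> p" "p < int l" "0 \<le> q" "q < int l"
    and "K x p mod int (n + 1) = K x q mod int (n + 1)"
  shows "p = q"
proof -
  have False if "p < q" "0 \<le> p" "q < int l" 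
      "K x p mod int (n + 1) = K x q mod int (n + 1)" for p q
  proof -
    have "K x p < K x q" using window_less[OF assms(1)] that by blast
    moreover have "K x q < K x p + int (n + 1)"
      using window_less[OF assms(1), of q "p + int l"] that by (simp only: window_periodic)
    moreover have "int (n + 1) dvd K x q - K x p" using that(4) by (metis mod_eq_dvd_iff)
    ultimately show False using zdvd_not_zless[of "K x q - K x p" "int (n + 1)"] by linarith
  qed
  then show ?thesis using assms by (metis linorder_less_linear)
qed

lemma mod_range_window:
  assumes "x \<in> affine_columns" "v mod int (n + 1) = w mod int (n + 1)"
  shows "v \<in> range (K x) \<longleftrightarrow> w \<in> range (K x)"
  by (simp only: range_window[OF assms(1)] assms(2) mem_Collect_eq)

lemma in_set_iff_range:
  assumes "(c, T) \<in> affine_columns" "1 \<le> i" "i \<le> n + 1"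
  shows "i \<in> set T \<longleftrightarrow> int i \<in> range (K (c, T))"
proof -
  have "int i mod int (n + 1) = int t mod int (n + 1) \<longleftrightarrow> i = t" if "t \<in> set T" for t
  proof -
    have t: "1 \<le> t" "t \<le> n + 1" using assms(1) that by (auto simp: in_columns_iff)
    have "int i mod int (n + 1) = int t mod int (n + 1) \<longleftrightarrow> (int i - 1) mod int (n + 1) = (int t - 1) mod int (n + 1)"
      by (simp add: mod_eq_dvd_iff)
    also have "\<dots> \<longleftrightarrow> i = t" using assms t by simp
    finally show ?thesis .
  qed
  then show ?thesis unfolding range_window[OF assms(1)] by auto
qed

section \<open>Promotion\<close>

lemma count_list_distinct: "distinct T \<Longrightarrow> count_list T a = of_bool (a \<in> set T)"
  by (induction T) auto

lemma promotion_no_last: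
  assumes "T \<in> columns n l" "n + 1 \<notin> set T" shows "promotion n T = map Suc T"
proof -
  have "map (\<lambda>k. if k = n + 1 then 1 else k + 1) T = map Suc T"
    using assms(2) by (auto intro!: map_cong)
  moreover have "sorted (map Suc T)"
    using assms(1) by (simp add: in_columns_iff strict_sorted_iff sorted_wrt_map)
  ultimately show ?thesis unfolding promotion_def by (simp only: sorted_sort_id)
qed

text \<open>
  The entry \<open>n + 1\<close> is the last one; promotion turns it into \<open>1\<close> and moves it to the front. The
  columns then differ by a rotation of positions, which the factor \<open>z\<^bsup>-1\<^esup>\<close> of the affinized
  promotion compensates.
\<close>

lemma promotion_last:
  assumes "T \<in> columns n l" "n + 1 \<in> set T"
  obtains S where "T = S @ [n + 1]" "promotion n T = 1 # map Suc S"
proof -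
  have T: "T \<noteq> []" using assms by auto
  define S where "S = butlast T"
  have TS: "T = S @ [last T]" using T by (simp add: S_def)
  have "last T = n + 1"
  proof (rule ccontr)
    assume "last T \<noteq> n + 1"
    then have "n + 1 \<in> set S" using assms(2) TS 
      by (metis Un_iff empty_iff insert_iff list.set set_append)
    then have "n + 1 < last T"
      using assms(1) TS sorted_wrt_append[of "(<)" S "[last T]"] by (auto simp: in_columns_iff)
    then show False using assms(1) last_in_set[OF T] by (auto simp: in_columns_iff)
  qed
  then have T': "T = S @ [n + 1]" using TS by simp
  then have S: "n + 1 \<notin> set S" "sorted_wrt (<) S"
    using assms(1) by (auto simp: in_columns_iff sorted_wrt_append)
  have "promotion n T = 1 # map Suc S"
    unfolding promotion_def
  proof (rule properties_for_sort)
    have eq: "map (\<lambda>k. if k = n + 1 then 1 else k + 1) S = map Suc S"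
      using S by (auto intro!: map_cong)
    show "mset (1 # map Suc S) = mset (map (\<lambda>k. if k = n + 1 then 1 else k + 1) T)"
      unfolding T' map_append eq by simp
    show "sorted (1 # map Suc S)"
      using S by (simp add: strict_sorted_iff sorted_wrt_map)
  qed
  with T' that show thesis by blast
qed

lemma promotion_in_columns:
  assumes "T \<in> columns n l" shows "promotion n T \<in> columns n l"
proof (cases "n + 1 \<in> set T")
  case False
  then show ?thesis using assms
    by (force simp: promotion_no_last in_columns_iff sorted_wrt_map le_less)
next
  case True
  then obtain S where "T = S @ [n + 1]" "promotion n T = 1 # map Suc S"
    using promotion_last assms by blast
  then show ?thesis using assms
    by (force simp: in_columns_iff sorted_wrt_map sorted_wrt_append)
qed

lemma set_promotion: "set (promotion n T) = (\<lambda>k. if k = n + 1 then 1 else k + 1) ` set T"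
  by (simp add: promotion_def)

lemma inj_on_promotion: "inj_on (promotion n) (columns n l)"
proof (rule inj_onI)
  fix T U assume *: "T \<in> columns n l" "U \<in> columns n l" "promotion n T = promotion n U"
  let ?g = "\<lambda>k. if k = n + 1 then 1 else k + 1"
  have "?g ` set T = ?g ` set U" by (metis *(3) set_promotion)
  moreover have "inj_on ?g {1..n + 1}" by (auto simp: inj_on_def)
  moreover have "set T \<subseteq> {1..n + 1}" "set U \<subseteq> {1..n + 1}" using * by (auto simp: columns_def)
  ultimately have "set T = set U" using inj_on_image_eq_iff[of ?g "{1..n + 1}" "set T" "set U"] by blast
  with * show "T = U" using columns_eqI by blast
qed

lemma promotion_image: "promotion n ` columns n l = columns n l"
proof (rule endo_inj_surj)
  have "columns n l \<subseteq> {T. set T \<subseteq> {1..n + 1} \<and> length T = l}" by (auto simp: columns_def)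
  then show "finite (columns n l)" using finite_lists_length_eq finite_subset by blast
qed (use inj_on_promotion promotion_in_columns in auto)

lemma inv_promotion:
  assumes "U \<in> columns n l"
  shows "inv_into (columns n l) (promotion n) U \<in> columns n l"
    and "promotion n (inv_into (columns n l) (promotion n) U) = U"
  using assms promotion_image inv_into_into[of U "promotion n" "columns n l"]
    f_inv_into_f[of U "promotion n" "columns n l"] by simp_all

lemma one_in_promotion: "T \<in> columns n l \<Longrightarrow> 1 \<in> set (promotion n T) \<longleftrightarrow> n + 1 \<in> set T"
  by (force simp: set_promotion in_columns_iff)

lemma aff_promotion_eq:
  "T \<in> columns n l \<Longrightarrow> aff_promotion n (c, T) = (c - of_bool (n + 1 \<in> set T), promotion n T)"
  by (auto simp: aff_promotion_def count_list_distinct in_columns_iff strict_sorted_iff)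

lemma aff_promotion_in: "x \<in> affine_columns \<Longrightarrow> aff_promotion n x \<in> affine_columns"
  by (auto simp: aff_promotion_def promotion_in_columns)

lemma inj_on_aff_promotion: "inj_on (aff_promotion n) affine_columns"
proof (rule inj_onI)
  fix x y assume "x \<in> affine_columns" "y \<in> affine_columns" "aff_promotion n x = aff_promotion n y"
  then show "x = y"
    using inj_on_promotion by (cases x; cases y) (auto simp: aff_promotion_def inj_on_def)
qed

text \<open>
  The purpose of windows: promotion has no case distinction left.
\<close>

lemma window_aff_promotion:
  assumes "x \<in> affine_columns" shows "K (aff_promotion n x) p = K x p + 1"
proof -
  obtain c T where x: "x = (c, T)" by (cases x)
  have T: "T \<in> columns n l" using assms x by auto
  define t where "t = p - c"
  define m where "m = t mod int l"
  have m: "0 \<le> m" "m < int l" using l_pos by (auto simp: m_def)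
  have nm: "nat m < length T" using m T by (auto simp: in_columns_iff nat_less_iff)
  show ?thesis
  proof (cases "n + 1 \<in> set T")
    case False
    then show ?thesis using nm unfolding x aff_promotion_eq[OF T] promotion_no_last[OF T False]
      by (simp add: window_def m_def t_def)
  next
    case True
    then obtain S where S: "T = S @ [n + 1]" "promotion n T = 1 # map Suc S"
      using promotion_last T by blast
    have len: "length S = l - 1" using T S by (auto simp: in_columns_iff)
    have eq: "p - (c - 1) = t + 1" by (simp add: t_def)
    show ?thesis
    proof (cases "m + 1 < int l")
      case True
      have dm: "(t + 1) mod int l = m + 1" "(t + 1) div int l = t div int l"
        using True div_mod_add_one_less[of "int l" t] l_pos by (simp_all add: m_def)
      have "nat (m + 1) = Suc (nat m)" "nat m < length S" using m True len by auto
      then have "promotion n T ! nat (m + 1) = T ! nat m + 1" unfolding S(2) unfolding S(1) by (simp add: nth_append)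
      then show ?thesis using \<open>n + 1 \<in> set T\<close>
        unfolding x aff_promotion_eq[OF T] window_def
        by (simp add: eq dm flip: t_def m_def)
    next
      case False
      then have ml: "m + 1 = int l" using m by simp
      have dm: "(t + 1) mod int l = 0" "(t + 1) div int l = t div int l + 1"
        using ml div_mod_add_one_eq[of "int l" t] l_pos by (simp_all add: m_def)
      have "nat m = length S" using ml len by simp
      then have "T ! nat m = n + 1" by (simp add: S)
      then show ?thesis using \<open>n + 1 \<in> set T\<close> S(2)
        unfolding x aff_promotion_eq[OF T] window_def
        by (simp add: eq dm distrib_left flip: t_def m_def)
    qed
  qed
qed

end

section \<open>Kashiwara operators on windows\<close>

lemma col_fin_inverse: "col_e_fin i U = Some T \<longleftrightarrow> col_f_fin i T = Some U"
proof
  assume "col_e_fin i U = Some T"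
  then show "col_f_fin i T = Some U"
    by (auto simp: col_e_fin_def col_f_fin_def image_iff o_def intro!: map_idI split: if_splits)
next
  assume "col_f_fin i T = Some U"
  then show "col_e_fin i U = Some T"
    by (auto simp: col_e_fin_def col_f_fin_def image_iff o_def intro!: map_idI split: if_splits)
qed

lemma sorted_wrt_less_map:
  fixes T :: "nat list"
  assumes "sorted_wrt (<) T" "\<And>x y. x \<in> set T \<Longrightarrow> y \<in> set T \<Longrightarrow> x < y \<Longrightarrow> g x < g y"
  shows "sorted_wrt (<) (map g T)"
  unfolding sorted_wrt_map using assms by (blast intro: sorted_wrt_mono_rel[of T "(<)"])

context column_shape begin

abbreviation "affine \<equiv> aff_crystal n l"
abbreviation "to_mono \<equiv> aff_to_mono n l"

lemma col_f_fin_in_columns: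
  assumes "T \<in> columns n l" "i \<le> n" "col_f_fin i T = Some U"
  shows "U \<in> columns n l"
proof -
  have U: "U = map (\<lambda>k. if k = i then i + 1 else k) T" "i + 1 \<notin> set T"
    using assms(3) by (auto simp: col_f_fin_def split: if_splits)
  have "sorted_wrt (<) U" unfolding U(1)
  proof (rule sorted_wrt_less_map)
    fix x y assume "x \<in> set T" "y \<in> set T" "x < y"
    moreover have "y \<noteq> i + 1" using \<open>y \<in> set T\<close> U(2) by blast
    ultimately show "(if x = i then i + 1 else x) < (if y = i then i + 1 else y)" by auto
  qed (use assms in \<open>simp add: in_columns_iff\<close>)
  then show ?thesis using assms U by (auto simp: in_columns_iff)
qed

lemma col_e_fin_in_columns:
  assumes "T \<in> columns n l" "1 \<le> i" "col_e_fin i T = Some U"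
  shows "U \<in> columns n l"
proof -
  have U: "U = map (\<lambda>k. if k = i + 1 then i else k) T" "i \<notin> set T"
    using assms(3) by (auto simp: col_e_fin_def split: if_splits)
  have "sorted_wrt (<) U" unfolding U(1)
  proof (rule sorted_wrt_less_map)
    fix x y assume "x \<in> set T" "y \<in> set T" "x < y"
    moreover have "x \<noteq> i" using \<open>x \<in> set T\<close> U(2) by blast
    ultimately show "(if x = i + 1 then i else x) < (if y = i + 1 then i else y)" by auto
  qed (use assms in \<open>simp add: in_columns_iff\<close>)
  then show ?thesis using assms U by (auto simp: in_columns_iff)
qed

lemma window_col_f_fin:
  assumes "T \<in> columns n l" "1 \<le> i" "i \<le> n" "col_f_fin i T = Some U"
  shows "K (c, U) p = raise n (int i) (K (c, T) p)"
proof -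
  have U: "U = map (\<lambda>k. if k = i then i + 1 else k) T"
    using assms(4) by (auto simp: col_f_fin_def split: if_splits)
  define m where "m = nat ((p - c) mod int l)"
  have m: "m < l" using l_pos by (simp add: m_def nat_less_iff)
  have t: "1 \<le> T ! m" "T ! m \<le> n + 1" using columns_nth[OF assms(1) m] by auto
  have "int (T ! m) mod int (n + 1) = int i mod int (n + 1) \<longleftrightarrow> T ! m = i"
  proof (cases "T ! m = n + 1")
    case True
    then show ?thesis using assms by simp
  next
    case False
    then show ?thesis using assms t by simp
  qed
  moreover have "U ! m = (if T ! m = i then i + 1 else T ! m)"
    using U m assms(1) by (simp add: in_columns_iff)
  ultimately show ?thesis
    unfolding window_def raise_def fst_conv snd_conv m_def[symmetric] mod_mult_self2 by simp
qed

lemma f_op_nonzero: "i \<noteq> 0 \<Longrightarrow> f_op affine i (c, T) = map_option (Pair c) (col_f_fin i T)"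
  by (simp add: aff_crystal_def col_f_def)

lemma e_op_nonzero: "i \<noteq> 0 \<Longrightarrow> e_op affine i (c, T) = map_option (Pair c) (col_e_fin i T)"
  by (simp add: aff_crystal_def col_e_def)

lemma f_op_zero:
  "f_op affine 0 (c, T) = map_option (\<lambda>U. (c - 1, inv_into (columns n l) (promotion n) U))
     (col_f_fin 1 (promotion n T))"
  by (simp add: aff_crystal_def col_f_def option.map_comp o_def)

lemma e_op_zero:
  "e_op affine 0 (c, T) = map_option (\<lambda>U. (c + 1, inv_into (columns n l) (promotion n) U))
     (col_e_fin 1 (promotion n T))"
  by (simp add: aff_crystal_def col_e_def option.map_comp o_def)

text \<open>
  The operators for \<open>i = 0\<close> are conjugates of those for \<open>i = 1\<close> under \<open>pr\<close>, and also with the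
  powers of \<open>z\<close> under \<open>pr\<^sub>a\<^sub>f\<^sub>f\<close>: the operator exchanges \<open>n + 1\<close> and \<open>1\<close> in the column, so
  exactly one of the two promotions involved contributes a power of \<open>z\<close>. Thus \<open>i = 0\<close> is reduced
  to \<open>i = 1\<close> everywhere below.
\<close>

lemma f_op_aff_promotion:
  assumes "x \<in> affine_columns"
  shows "f_op affine 1 (aff_promotion n x) = map_option (aff_promotion n) (f_op affine 0 x)"
    and "f_op affine 0 x = Some y \<Longrightarrow> y \<in> affine_columns"
proof -
  obtain c T where x: "x = (c, T)" by (cases x)
  have T: "T \<in> columns n l" using assms x by auto
  let ?inv = "inv_into (columns n l) (promotion n)"
  have U_in: "U \<in> columns n l" if "col_f_fin 1 (promotion n T) = Some U" for U
    using col_f_fin_in_columns[OF promotion_in_columns[OF T] _ that] n_ge by simp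
  then show "f_op affine 0 x = Some y \<Longrightarrow> y \<in> affine_columns"
    unfolding x f_op_zero using inv_promotion(1) by auto
  show "f_op affine 1 (aff_promotion n x) = map_option (aff_promotion n) (f_op affine 0 x)"
  proof (cases "col_f_fin 1 (promotion n T)")
    case None
    then show ?thesis by (simp add: x f_op_zero f_op_nonzero aff_promotion_eq[OF T] del: One_nat_def)
  next
    case (Some U)
    have "1 \<in> set (promotion n T)" "1 \<notin> set U"
      using Some by (auto simp: col_f_fin_def split: if_splits)
    then have "n + 1 \<in> set T" "n + 1 \<notin> set (?inv U)"
      using one_in_promotion[OF T] one_in_promotion[OF inv_promotion(1)[OF U_in[OF Some]]]
        inv_promotion(2)[OF U_in[OF Some]] by auto
    then show ?thesis
      using Some inv_promotion[OF U_in[OF Some]] 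
      by (simp add: x f_op_zero f_op_nonzero aff_promotion_eq T del: One_nat_def)
  qed
qed

lemma e_op_aff_promotion:
  assumes "x \<in> affine_columns"
  shows "e_op affine 1 (aff_promotion n x) = map_option (aff_promotion n) (e_op affine 0 x)"
    and "e_op affine 0 x = Some y \<Longrightarrow> y \<in> affine_columns"
proof -
  obtain c T where x: "x = (c, T)" by (cases x)
  have T: "T \<in> columns n l" using assms x by auto
  let ?inv = "inv_into (columns n l) (promotion n)"
  have U_in: "U \<in> columns n l" if "col_e_fin 1 (promotion n T) = Some U" for U
    using col_e_fin_in_columns[OF promotion_in_columns[OF T] _ that] by simp
  then show "e_op affine 0 x = Some y \<Longrightarrow> y \<in> affine_columns"
    unfolding x e_op_zero using inv_promotion(1) by auto
  show "e_op affine 1 (aff_promotion n x) = map_option (aff_promotion n) (e_op affine 0 x)"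
  proof (cases "col_e_fin 1 (promotion n T)")
    case None
    then show ?thesis by (simp add: x e_op_zero e_op_nonzero aff_promotion_eq[OF T] del: One_nat_def)
  next
    case (Some U)
    then have "col_f_fin 1 U = Some (promotion n T)" by (simp add: col_fin_inverse)
    then have "1 \<in> set U" by (auto simp: col_f_fin_def split: if_splits)
    moreover have "1 \<notin> set (promotion n T)"
      using Some by (auto simp: col_e_fin_def split: if_splits)
    ultimately have "n + 1 \<notin> set T" "n + 1 \<in> set (?inv U)"
      using one_in_promotion[OF T] one_in_promotion[OF inv_promotion(1)[OF U_in[OF Some]]]
        inv_promotion(2)[OF U_in[OF Some]] by auto
    then show ?thesis
      using Some inv_promotion[OF U_in[OF Some]] 
      by (simp add: x e_op_zero e_op_nonzero aff_promotion_eq T del: One_nat_def)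
  qed
qed

lemma range_window_aff_promotion:
  assumes "x \<in> affine_columns" shows "v + 1 \<in> range (K (aff_promotion n x)) \<longleftrightarrow> v \<in> range (K x)"
  using window_aff_promotion[OF assms] by (auto simp: image_iff)

text \<open>
  On windows the node \<open>0\<close> is no longer special, because raising commutes with adding one to all
  entries and to \<open>i\<close>.
\<close>

lemma
  assumes "x \<in> affine_columns" "i \<le> n"
  shows f_op_defined_iff:
      "f_op affine i x \<noteq> None \<longleftrightarrow> int i \<in> range (K x) \<and> int i + 1 \<notin> range (K x)" (is ?A)
    and f_op_in: "f_op affine i x = Some y \<Longrightarrow> y \<in> affine_columns" (is "_ \<Longrightarrow> ?B")
    and window_f_op: "f_op affine i x = Some y \<Longrightarrow> K y p = raise n (int i) (K x p)" (is "_ \<Longrightarrow> ?C")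
proof -
  have pos: "(f_op affine i x \<noteq> None \<longleftrightarrow> int i \<in> range (K x) \<and> int i + 1 \<notin> range (K x)) \<and>
      (\<forall>y. f_op affine i x = Some y \<longrightarrow> y \<in> affine_columns \<and> (\<forall>p. K y p = raise n (int i) (K x p)))"
    if "x \<in> affine_columns" "1 \<le> i" "i \<le> n" for x i
  proof -
    obtain c T where x: "x = (c, T)" by (cases x)
    have T: "T \<in> columns n l" using that x by auto
    have "f_op affine i x \<noteq> None \<longleftrightarrow> i \<in> set T \<and> i + 1 \<notin> set T"
      using that by (auto simp: x f_op_nonzero col_f_fin_def)
    also have "\<dots> \<longleftrightarrow> int i \<in> range (K x) \<and> int i + 1 \<notin> range (K x)"
      using in_set_iff_range[of c T i] in_set_iff_range[of c T "i + 1"] that 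
      by (simp add: x add.commute)
    finally show ?thesis
      using that T col_f_fin_in_columns window_col_f_fin by (fastforce simp: x f_op_nonzero)
  qed
  have "?A \<and> (f_op affine i x = Some y \<longrightarrow> ?B \<and> ?C)"
  proof (cases "i = 0")
    case False
    then have "1 \<le> i" by simp
    from pos[OF assms(1) this assms(2)] show ?thesis by blast
  next
    case True
    have pr: "aff_promotion n x \<in> affine_columns" using assms aff_promotion_in by blast
    have A: "f_op affine 1 (aff_promotion n x) \<noteq> None \<longleftrightarrow> 0 \<in> range (K x) \<and> 1 \<notin> range (K x)"
      using pos[OF pr, of 1] n_ge range_window_aff_promotion[OF assms(1), of 0]
       range_window_aff_promotion[OF assms(1), of 1] by simp
    have C: "K y p = raise n 0 (K x p)" if "f_op affine 0 x = Some y"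
    proof -
      have y: "y \<in> affine_columns" using f_op_aff_promotion(2) assms(1) that by blast
      have "f_op affine 1 (aff_promotion n x) = Some (aff_promotion n y)"
        using f_op_aff_promotion(1)[OF assms(1)] that by simp
      then have "K (aff_promotion n y) p = raise n 1 (K (aff_promotion n x) p)"
        using pos[OF pr, of 1] n_ge by simp
      moreover have "(K x p + 1) mod int (n + 1) = 1 mod int (n + 1) \<longleftrightarrow> K x p mod int (n + 1) = 0 mod int (n + 1)"
        by (simp only: mod_eq_dvd_iff) simp
      ultimately show ?thesis 
        unfolding window_aff_promotion[OF y] window_aff_promotion[OF assms(1)] raise_def
        by (auto split: if_splits)
    qed
    from A have "f_op affine 0 x \<noteq> None \<longleftrightarrow> 0 \<in> range (K x) \<and> 1 \<notin> range (K x)"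
      unfolding f_op_aff_promotion(1)[OF assms(1)] option.map_disc_iff .
    then show ?thesis using C f_op_aff_promotion(2)[OF assms(1)] True by simp
  qed
  then show ?A "f_op affine i x = Some y \<Longrightarrow> ?B" "f_op affine i x = Some y \<Longrightarrow> ?C" by blast+
qed

lemma e_op_iff_f_op:
  assumes "x \<in> affine_columns" "y \<in> affine_columns"
  shows "e_op affine i y = Some x \<longleftrightarrow> f_op affine i x = Some y"
proof -
  have pos: "e_op affine i y = Some x \<longleftrightarrow> f_op affine i x = Some y" if "i \<noteq> 0" for x y i
    using that by (cases x; cases y) (auto simp: e_op_nonzero f_op_nonzero col_fin_inverse)
  show ?thesis
  proof (cases "i = 0")
    case True
    have inj: "z = w" if "aff_promotion n z = aff_promotion n w" "z \<in> affine_columns" "w \<in> affine_columns" for z w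
      using inj_on_aff_promotion that by (auto dest: inj_onD)
    have "e_op affine 0 y = Some x \<longleftrightarrow> e_op affine 1 (aff_promotion n y) = Some (aff_promotion n x)"
      unfolding e_op_aff_promotion(1)[OF assms(2)] 
      using e_op_aff_promotion(2)[OF assms(2)] inj assms(1) by auto
    also have "\<dots> \<longleftrightarrow> f_op affine 1 (aff_promotion n x) = Some (aff_promotion n y)"
      by (rule pos) simp
    also have "\<dots> \<longleftrightarrow> f_op affine 0 x = Some y"
      unfolding f_op_aff_promotion(1)[OF assms(1)] 
      using f_op_aff_promotion(2)[OF assms(1)] inj assms(2) by auto
    finally show ?thesis using True by simp
  qed (rule pos)
qed

lemma
  assumes "x \<in> affine_columns" "i \<le> n"
  shows e_op_in: "e_op affine i x = Some y \<Longrightarrow> y \<in> affine_columns"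
    and e_op_defined_iff:
      "e_op affine i x \<noteq> None \<longleftrightarrow> int i + 1 \<in> range (K x) \<and> int i \<notin> range (K x)"
proof -
  have pos: "(e_op affine i x \<noteq> None \<longleftrightarrow> int i + 1 \<in> range (K x) \<and> int i \<notin> range (K x)) \<and>
      (\<forall>y. e_op affine i x = Some y \<longrightarrow> y \<in> affine_columns)"
    if "x \<in> affine_columns" "1 \<le> i" "i \<le> n" for x i
  proof -
    obtain c T where x: "x = (c, T)" by (cases x)
    have T: "T \<in> columns n l" using that x by auto
    have "e_op affine i x \<noteq> None \<longleftrightarrow> i + 1 \<in> set T \<and> i \<notin> set T"
      using that by (auto simp: x e_op_nonzero col_e_fin_def)
    also have "\<dots> \<longleftrightarrow> int i + 1 \<in> range (K x) \<and> int i \<notin> range (K x)"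
      using in_set_iff_range[of c T i] in_set_iff_range[of c T "i + 1"] that 
      by (simp add: x add.commute)
    finally show ?thesis
      using that T col_e_fin_in_columns by (fastforce simp: x e_op_nonzero)
  qed
  have "(e_op affine i x \<noteq> None \<longleftrightarrow> int i + 1 \<in> range (K x) \<and> int i \<notin> range (K x)) \<and>
      (e_op affine i x = Some y \<longrightarrow> y \<in> affine_columns)"
  proof (cases "i = 0")
    case False
    then have "1 \<le> i" by simp
    from pos[OF assms(1) this assms(2)] show ?thesis by blast
  next
    case True
    have pr: "aff_promotion n x \<in> affine_columns" using assms aff_promotion_in by blast
    have A: "e_op affine 1 (aff_promotion n x) \<noteq> None \<longleftrightarrow> 1 \<in> range (K x) \<and> 0 \<notin> range (K x)"
      using pos[OF pr, of 1] n_ge range_window_aff_promotion[OF assms(1), of 0]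
       range_window_aff_promotion[OF assms(1), of 1] by simp
    then have "e_op affine 0 x \<noteq> None \<longleftrightarrow> 1 \<in> range (K x) \<and> 0 \<notin> range (K x)"
      unfolding e_op_aff_promotion(1)[OF assms(1)] option.map_disc_iff .
    then show ?thesis using e_op_aff_promotion(2)[OF assms(1)] True by simp
  qed
  then show "e_op affine i x = Some y \<Longrightarrow> y \<in> affine_columns"
    "e_op affine i x \<noteq> None \<longleftrightarrow> int i + 1 \<in> range (K x) \<and> int i \<notin> range (K x)" by blast+
qed

lemma e_op_Some_iff:
  assumes "x \<in> affine_columns" "i \<le> n"
  shows "e_op affine i x = Some y \<longleftrightarrow> y \<in> affine_columns \<and> f_op affine i y = Some x"
  using e_op_in[OF assms] e_op_iff_f_op[OF _ assms(1)] by blast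

section \<open>String lengths\<close>

lemma max_steps_None: "g x = None \<Longrightarrow> max_steps g x = 0"
proof -
  assume g: "g x = None"
  have "((\<lambda>y. Option.bind y g) ^^ Suc k) (Some x) = None" for k
    by (induction k) (auto simp: g)
  then have "((\<lambda>y. Option.bind y g) ^^ k) (Some x) = None" if "k > 0" for k
    using that by (metis gr0_conv_Suc)
  then show ?thesis unfolding max_steps_def
    by (intro Greatest_equality) (use neq0_conv in fastforce)+
qed

text \<open>
  Columns are minuscule: every string has length at most one.
\<close>

lemma max_steps_one: "g x = Some y \<Longrightarrow> g y = None \<Longrightarrow> max_steps g x = 1"
proof -
  assume g: "g x = Some y" "g y = None"
  have two: "((\<lambda>y. Option.bind y g) ^^ k) (Some x) = None" if "k \<ge> 2" for k
    using that by (induction k rule: dec_induct) (auto simp: g numeral_2_eq_2)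
  show ?thesis unfolding max_steps_def
  proof (rule Greatest_equality)
    fix k assume "((\<lambda>y. Option.bind y g) ^^ k) (Some x) \<noteq> None"
    then show "k \<le> 1" using two[of k] by fastforce
  qed (simp add: g)
qed

lemma range_raise:
  assumes "x \<in> affine_columns" "i \<le> n" "f_op affine i x = Some y"
  shows "v \<in> range (K y) \<longleftrightarrow> v \<in> range (K x) \<and> v mod int (n + 1) \<noteq> int i mod int (n + 1)
    \<or> v mod int (n + 1) = (int i + 1) mod int (n + 1)"
proof
  assume "v \<in> range (K y)"
  then obtain p where "v = raise n (int i) (K x p)" using window_f_op[OF assms] by auto
  then show "v \<in> range (K x) \<and> v mod int (n + 1) \<noteq> int i mod int (n + 1)
    \<or> v mod int (n + 1) = (int i + 1) mod int (n + 1)"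
    by (auto simp: raise_def simp del: of_nat_add of_nat_Suc split: if_splits intro: mod_add_cong)
next
  assume "v \<in> range (K x) \<and> v mod int (n + 1) \<noteq> int i mod int (n + 1)
    \<or> v mod int (n + 1) = (int i + 1) mod int (n + 1)"
  then show "v \<in> range (K y)"
  proof (elim disjE conjE)
    assume *: "v \<in> range (K x)" "v mod int (n + 1) \<noteq> int i mod int (n + 1)"
    then obtain p where "v = K x p" by auto
    then have "K y p = v" using * window_f_op[OF assms, of p] by (simp add: raise_def)
    then show ?thesis by blast
  next
    assume *: "v mod int (n + 1) = (int i + 1) mod int (n + 1)"
    then have i: "(v - 1) mod int (n + 1) = int i mod int (n + 1)"
      by (simp add: mod_eq_dvd_iff algebra_simps)
    have "int i \<in> range (K x)" using f_op_defined_iff[OF assms(1,2)] assms(3) by simp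
    then have "v - 1 \<in> range (K x)" using mod_range_window[OF assms(1) i] by simp
    then obtain p where p: "v - 1 = K x p" by auto
    then have "K y p = v" using i window_f_op[OF assms, of p] unfolding raise_def p[symmetric] by simp
    then show ?thesis by (metis rangeI)
  qed
qed

lemma f_op_twice: "x \<in> affine_columns \<Longrightarrow> i \<le> n \<Longrightarrow> f_op affine i x = Some y \<Longrightarrow> f_op affine i y = None"
proof -
  assume *: "x \<in> affine_columns" "i \<le> n" "f_op affine i x = Some y"
  have "int i + 1 \<in> range (K y)" using range_raise[OF *] by blast
  then show ?thesis using f_op_defined_iff[OF f_op_in[OF *] *(2)] by blast
qed

lemma e_op_twice: "x \<in> affine_columns \<Longrightarrow> i \<le> n \<Longrightarrow> e_op affine i x = Some y \<Longrightarrow> e_op affine i y = None"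
proof -
  assume *: "x \<in> affine_columns" "i \<le> n" "e_op affine i x = Some y"
  then have "y \<in> affine_columns" "f_op affine i y = Some x" using e_op_Some_iff by blast+
  then have "int i \<in> range (K y)" using f_op_defined_iff[of y i] *(2) by simp
  then show ?thesis using e_op_defined_iff[OF \<open>y \<in> affine_columns\<close> *(2)] by blast
qed

lemma phi_aff:
  assumes "x \<in> affine_columns" "i \<le> n"
  shows "phi affine i x = of_bool (f_op affine i x \<noteq> None)"
proof -
  obtain c T where x: "x = (c, T)" by (cases x)
  have f: "f_op affine i (c, T) = map_option (Pair (if i = 0 then c - 1 else c)) (col_f n l i T)" for c T
    by (simp add: aff_crystal_def)
  have "max_steps (col_f n l i) T = of_bool (col_f n l i T \<noteq> None)"
  proof (cases "col_f n l i T")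
    case (Some U)
    then have "f_op affine i x = Some (if i = 0 then c - 1 else c, U)" using f x by simp
    then have "f_op affine i (if i = 0 then c - 1 else c, U) = None" using f_op_twice assms by blast
    then show ?thesis using Some f by (auto simp: max_steps_one)
  qed (simp add: max_steps_None)
  then show ?thesis using f[of c T] by (simp add: aff_crystal_def x)
qed

lemma eps_aff:
  assumes "x \<in> affine_columns" "i \<le> n"
  shows "eps affine i x = of_bool (e_op affine i x \<noteq> None)"
proof -
  obtain c T where x: "x = (c, T)" by (cases x)
  have e: "e_op affine i (c, T) = map_option (Pair (if i = 0 then c + 1 else c)) (col_e n l i T)" for c T
    by (simp add: aff_crystal_def)
  have "max_steps (col_e n l i) T = of_bool (col_e n l i T \<noteq> None)"
  proof (cases "col_e n l i T")
    case (Some U)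
    then have "e_op affine i x = Some (if i = 0 then c + 1 else c, U)" using e x by simp
    then have "e_op affine i (if i = 0 then c + 1 else c, U) = None" using e_op_twice assms by blast
    then show ?thesis using Some e by (auto simp: max_steps_one)
  qed (simp add: max_steps_None)
  then show ?thesis using e[of c T] by (simp add: aff_crystal_def x)
qed

section \<open>Weights\<close>

lemma cartan_sum:
  assumes "j \<le> n" shows "(\<Sum>i\<le>n. cartan n j i) = 0"
proof -
  have eq: "cartan n j i = 2 * of_bool (i = j) - of_bool (i = (j + 1) mod (n + 1)) 
      - of_bool (i = (j + n) mod (n + 1))" if "i \<le> n" for i
  proof -
    have a: "(j + 1) mod (n + 1) = (if j = n then 0 else j + 1)" using assms by simp
    have b: "(i + 1) mod (n + 1) = (if i = n then 0 else i + 1)" using that by simp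
    have c: "(j + n) mod (n + 1) = (if j = 0 then n else j - 1)" 
    proof (cases j)
      case (Suc k)
      then have "j + n = k + (n + 1)" by simp
      then show ?thesis using Suc assms by (metis Suc_eq_plus1 diff_Suc_1 le_imp_less_Suc less_SucI
            mod_add_self2 mod_less nat.distinct(1) Suc_le_lessD less_imp_le_nat)
    qed simp
    show ?thesis unfolding cartan_def a b c using assms that n_ge by auto
  qed
  have "(\<Sum>i\<le>n. cartan n j i) = (\<Sum>i\<le>n. 2 * of_bool (i = j) - of_bool (i = (j + 1) mod (n + 1)) 
      - of_bool (i = (j + n) mod (n + 1)))"
    by (rule sum.cong) (simp_all add: eq)
  also have "\<dots> = 2 * (\<Sum>i\<le>n. of_bool (i = j)) - (\<Sum>i\<le>n. of_bool (i = (j + 1) mod (n + 1))) 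
      - (\<Sum>i\<le>n. of_bool (i = (j + n) mod (n + 1)))"
    by (simp only: sum_subtractf sum_distrib_left)
  also have "\<dots> = 0" using assms by (simp add: of_bool_def sum.delta' sum.delta less_Suc_eq_le[symmetric] del: mod_Suc_eq)
  finally show ?thesis .
qed

lemma delta_H: "delta n (H j) = 0"
proof (cases "j \<le> n")
  case True
  have "delta n (H j) = of_int (\<Sum>i\<le>n. cartan n j i)"
    by (simp add: delta_def sum_apply simple_root_def True)
  then show ?thesis using cartan_sum True by simp
qed (simp add: delta_def sum_apply simple_root_def)

lemma delta_D: "delta n D = 1"
  by (simp add: delta_def sum_apply simple_root_def sum.delta)

lemma sum_list_apply: "sum_list (map f xs) b = (\<Sum>x\<leftarrow>xs. f x b)"
  for f :: "'a \<Rightarrow> 'b \<Rightarrow> 'c::comm_monoid_add"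
  by (induction xs) auto

lemma wt_D: "wt affine (c, T) D = of_int c"
proof -
  have "col_wt n T D = 0" by (simp add: col_wt_def sum_list_apply fund_weight_def)
  then show ?thesis by (simp add: aff_crystal_def scale_def delta_D)
qed

text \<open>
  Entries \<open>k\<close> contribute \<open>\<Lambda>\<^sub>k - \<Lambda>\<^sub>k\<^sub>-\<^sub>1\<close>, so \<open>h\<^sub>j\<close> sees just the entries congruent to \<open>j\<close> and
  to \<open>j + 1\<close>; since \<open>\<delta>\<close> vanishes on \<open>h\<^sub>j\<close>, the power of \<open>z\<close> does not contribute.
\<close>

lemma wt_H:
  assumes "x \<in> affine_columns"
  shows "wt affine x (H j) = (if j \<le> n then of_bool (int j \<in> range (K x)) - of_bool (int j + 1 \<in> range (K x)) else 0)"
proof -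
  obtain c T where x: "x = (c, T)" by (cases x)
  have T: "T \<in> columns n l" using assms x by auto
  have "distinct T" using T by (auto simp: in_columns_iff strict_sorted_iff)
  have "wt affine x (H j) = (\<Sum>t\<leftarrow>T. of_bool (j = t mod (n + 1)) - of_bool (j = (t - 1) mod (n + 1)))"
    by (simp add: x aff_crystal_def scale_def delta_H col_wt_def sum_list_apply fund_weight_def of_bool_def)
  also have "\<dots> = (\<Sum>t\<in>set T. of_bool (j = t mod (n + 1)) - of_bool (j = (t - 1) mod (n + 1)))"
    using \<open>distinct T\<close> by (simp add: sum_list_distinct_conv_sum_set)
  also have "\<dots> = (if j \<le> n then of_bool (int j \<in> range (K x)) - of_bool (int j + 1 \<in> range (K x)) else 0)"
  proof (cases "j \<le> n")
    case True
    \<comment> \<open>the entry congruent to \<open>j\<close>, which is \<open>n + 1\<close> for \<open>j = 0\<close>\<close>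
    define j' where "j' = (if j = 0 then n + 1 else j)"
    have "(\<Sum>t\<in>set T. of_bool (j = t mod (n + 1)) - of_bool (j = (t - 1) mod (n + 1)))
        = (\<Sum>t\<in>set T. of_bool (t = j') - of_bool (t = j + 1) :: rat)"
    proof (rule sum.cong)
      fix t assume "t \<in> set T"
      then have t: "1 \<le> t" "t \<le> n + 1" using T by (auto simp: in_columns_iff)
      have "j = t mod (n + 1) \<longleftrightarrow> t = j'" using t True by (cases "t = n + 1") (auto simp: j'_def)
      moreover have "j = (t - 1) mod (n + 1) \<longleftrightarrow> t = j + 1" using t True by auto
      ultimately show "of_bool (j = t mod (n + 1)) - of_bool (j = (t - 1) mod (n + 1)) = 
         (of_bool (t = j') - of_bool (t = j + 1) :: rat)" by simp
    qed simp
    also have "\<dots> = of_bool (j' \<in> set T) - of_bool (j + 1 \<in> set T)"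
      by (simp add: sum_subtractf of_bool_def sum.delta)
    also have "j' \<in> set T \<longleftrightarrow> int j' \<in> range (K x)"
      unfolding x using in_set_iff_range[of c T j'] T True by (auto simp: j'_def)
    also have "int j' \<in> range (K x) \<longleftrightarrow> int j \<in> range (K x)"
      by (rule mod_range_window[OF assms]) (simp add: j'_def)
    also have "j + 1 \<in> set T \<longleftrightarrow> int (j + 1) \<in> range (K x)"
      unfolding x using in_set_iff_range[of c T "j + 1"] T True by auto
    finally show ?thesis using True by (simp add: add.commute)
  next
    case False
    moreover have "t mod (n + 1) < n + 1" for t by (rule mod_less_divisor) simp
    ultimately have "j \<noteq> t mod (n + 1)" for t by (metis Suc_eq_plus1 less_Suc_eq_le)
    with False show ?thesis by simp
  qed
  finally show ?thesis .
qed

lemma f_op_fst: "f_op affine i (c, T) = Some y \<Longrightarrow> fst y = c - of_bool (i = 0)"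
  by (auto simp: aff_crystal_def)

lemma wt_f_op:
  assumes "x \<in> affine_columns" "i \<le> n" "f_op affine i x = Some y"
  shows "wt affine y = wt affine x - simple_root n i"
proof
  fix b
  have y: "y \<in> affine_columns" using f_op_in assms by blast
  show "wt affine y b = (wt affine x - simple_root n i) b"
  proof (cases b)
    case D
    obtain c T d U where xy: "x = (c, T)" "y = (d, U)" by (cases x; cases y)
    then have "d = c - of_bool (i = 0)" using f_op_fst[of i c T y] assms(3) by simp
    then show ?thesis unfolding D xy wt_D minus_apply by (simp add: wt_D simple_root_def)
  next
    case (H j)
    show ?thesis
    proof (cases "j \<le> n")
      case False
      then show ?thesis by (simp add: H wt_H[OF y] wt_H[OF assms(1)] simple_root_def)
    next
      case True
      have i: "int i \<in> range (K x)" "int i + 1 \<notin> range (K x)"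
        using f_op_defined_iff[OF assms(1,2)] assms(3) by auto
      have ij: "int j mod int (n + 1) = int i mod int (n + 1) \<longleftrightarrow> j = i" 
        using True assms(2) by simp
      have ij1: "(int j + 1) mod int (n + 1) = (int i + 1) mod int (n + 1) \<longleftrightarrow> j = i"
        unfolding ij[symmetric] by (simp add: mod_eq_dvd_iff)
      have ji: "int j mod int (n + 1) = (int i + 1) mod int (n + 1) \<longleftrightarrow> j = (i + 1) mod (n + 1)"
        using True by (metis of_nat_eq_iff of_nat_add of_nat_1 zmod_int mod_less less_Suc_eq_le Suc_eq_plus1)
      have ji': "(int j + 1) mod int (n + 1) = int i mod int (n + 1) \<longleftrightarrow> i = (j + 1) mod (n + 1)"
        using assms(2) by (metis of_nat_eq_iff of_nat_add of_nat_1 zmod_int mod_less less_Suc_eq_le Suc_eq_plus1)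
      have jR: "int j \<in> range (K x) \<longleftrightarrow> int i \<in> range (K x)" if "j = i" using that by simp
      have jR1: "int j \<in> range (K x) \<longleftrightarrow> int i + 1 \<in> range (K x)" if "j = (i + 1) mod (n + 1)"
        by (rule mod_range_window[OF assms(1)]) (use ji that in blast)
      have jR2: "int j + 1 \<in> range (K x) \<longleftrightarrow> int i \<in> range (K x)" if "i = (j + 1) mod (n + 1)"
        by (rule mod_range_window[OF assms(1)]) (use ji' that in blast)
      have a: "(j + 1) mod (n + 1) = (if j = n then 0 else j + 1)" using True by simp
      have b: "(i + 1) mod (n + 1) = (if i = n then 0 else i + 1)" using assms(2) by simp
      have excl: "\<not> (j = i \<and> j = (i + 1) mod (n + 1))" "\<not> (j = i \<and> i = (j + 1) mod (n + 1))" 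
        "\<not> (j = (i + 1) mod (n + 1) \<and> i = (j + 1) mod (n + 1))"
        unfolding a b using n_ge by auto
      have "wt affine y (H j) - wt affine x (H j) = - of_int (cartan n j i)"
        unfolding wt_H[OF y] wt_H[OF assms(1)] range_raise[OF assms] ij ij1 ji ji' cartan_def
        using True i jR jR1 jR2 excl by (auto simp: of_bool_def)
      then show ?thesis using True by (simp add: H simple_root_def algebra_simps)
    qed
  qed
qed

end

section \<open>Morphism of crystals\<close>

lemma sum_of_bool_single:
  assumes "finite A" "p0 \<in> A" "\<And>p. p \<in> A \<Longrightarrow> P p \<longleftrightarrow> p = p0"
  shows "(\<Sum>p\<in>A. of_bool (P p \<and> k = g p)) = (of_bool (k = g p0) :: int)"
proof -
  have "(\<Sum>p\<in>A. of_bool (P p \<and> k = g p)) = (\<Sum>p\<in>A. if p = p0 then of_bool (k = g p0) else 0 :: int)"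
    using assms by (intro sum.cong) auto
  then show ?thesis using assms by simp
qed

context column_shape begin

text \<open>
  Row \<open>i\<close> of the exponents: an entry congruent to \<open>i\<close> contributes a positive factor, an entry
  congruent to \<open>i + 1\<close> a negative one. As entries are distinct modulo \<open>n + 1\<close>, there is at most one
  factor of each sign.
\<close>

lemma window_exp_row:
  "window_exp n l L i k =
     (\<Sum>p = 0..<int l. of_bool (int i = L p mod int (n + 1) \<and> k = int l - 2 - 2 * p + L p)) -
     (\<Sum>p = 0..<int l. of_bool (int i = (L p - 1) mod int (n + 1) \<and> k = int l - 1 - 2 * p + L p))"
proof -
  have "window_exp n l L i k = (\<Sum>p = 0..<int l. 
     of_bool (int i = L p mod int (n + 1) \<and> k = int l - 2 - 2 * p + L p)
   - of_bool (int i = (L p - 1) mod int (n + 1) \<and> k = int l - 1 - 2 * p + L p))"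
    unfolding window_exp_def sum_apply box_def
  proof (rule sum.cong)
    fix p
    have "int l - 1 - 2 * p + L p - 1 = int l - 2 - 2 * p + L p" by simp
    then show "of_bool (int i = L p mod int (n + 1) \<and> k = int l - 1 - 2 * p + L p - 1) -
         of_bool (int i = (L p - 1) mod int (n + 1) \<and> k = int l - 1 - 2 * p + L p) =
         of_bool (int i = L p mod int (n + 1) \<and> k = int l - 2 - 2 * p + L p) -
         of_bool (int i = (L p - 1) mod int (n + 1) \<and> k = int l - 1 - 2 * p + L p)" by simp
  qed simp
  then show ?thesis by (simp only: sum_subtractf)
qed

lemma row_pos:
  assumes "x \<in> affine_columns" "0 \<le> p" "p < int l" "K x p mod int (n + 1) = int i"
  shows "(\<Sum>q = 0..<int l. of_bool (int i = K x q mod int (n + 1) \<and> k = int l - 2 - 2 * q + K x q))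
    = (of_bool (k = int l - 2 - 2 * p + K x p) :: int)"
  by (rule sum_of_bool_single) (use assms window_inj_mod[OF assms(1)] in auto)

lemma row_pos_none:
  assumes "x \<in> affine_columns" "int i \<notin> range (K x)"
  shows "(\<Sum>q = 0..<int l. of_bool (int i = K x q mod int (n + 1) \<and> k = g q)) = (0 :: int)"
proof -
  have "int i \<noteq> K x q mod int (n + 1)" for q
    using mod_range_window[OF assms(1), of "K x q" "K x q mod int (n + 1)"] assms(2) by auto
  then show ?thesis by simp
qed

lemma row_neg:
  assumes "x \<in> affine_columns" "i \<le> n" "0 \<le> p" "p < int l" "K x p mod int (n + 1) = (int i + 1) mod int (n + 1)"
  shows "(\<Sum>q = 0..<int l. of_bool (int i = (K x q - 1) mod int (n + 1) \<and> k = int l - 1 - 2 * q + K x q))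
    = (of_bool (k = int l - 1 - 2 * p + K x p) :: int)"
proof (rule sum_of_bool_single)
  fix q assume q: "q \<in> {0..<int l}"
  have "int i = (K x q - 1) mod int (n + 1) \<longleftrightarrow> int i mod int (n + 1) = (K x q - 1) mod int (n + 1)"
    using assms(2) by simp
  also have "\<dots> \<longleftrightarrow> K x p mod int (n + 1) = K x q mod int (n + 1)"
    unfolding assms(5) by (simp add: mod_eq_dvd_iff algebra_simps)
  also have "\<dots> \<longleftrightarrow> q = p" using window_inj_mod[OF assms(1)] assms q by auto
  finally show "int i = (K x q - 1) mod int (n + 1) \<longleftrightarrow> q = p" .
qed (use assms in auto)

lemma row_neg_none:
  assumes "x \<in> affine_columns" "int i + 1 \<notin> range (K x)"
  shows "(\<Sum>q = 0..<int l. of_bool (int i = (K x q - 1) mod int (n + 1) \<and> k = g q)) = (0 :: int)"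
proof -
  have "int i \<noteq> (K x q - 1) mod int (n + 1)" for q
  proof
    assume "int i = (K x q - 1) mod int (n + 1)"
    then have "(int i + 1) mod int (n + 1) = K x q mod int (n + 1)"
      by (simp only: mod_add_left_eq diff_add_cancel)
    then show False using mod_range_window[OF assms(1), of "int i + 1" "K x q"] assms(2) by blast
  qed
  then show ?thesis by simp
qed

text \<open>
  If \<open>i\<close> and \<open>i + 1\<close> both occur, the negative factor of row \<open>i\<close> does not come after the positive
  one. Either the entry congruent to \<open>i + 1\<close> is the next one, and the two factors cancel; or the
  entry congruent to \<open>i\<close> is at the end of the window and the other at its beginning, and then the
  factors are \<open>n + 1 - 2l\<close> apart.
\<close>

lemma neighbours_positions:
  assumes "x \<in> affine_columns" "0 \<le> p" "p < int l" "0 \<le> q" "q < int l"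
    and "K x q mod int (n + 1) = (K x p + 1) mod int (n + 1)"
  shows "int l - 1 - 2 * q + K x q \<le> int l - 2 - 2 * p + K x p"
proof -
  have dvd: "int (n + 1) dvd K x p + 1 - K x q" using assms(6) by (metis mod_eq_dvd_iff)
  consider "p < q" | "p = q" | "q < p" by linarith
  then show ?thesis
  proof cases
    case 1
    have "K x p < K x q" "K x q < K x (p + int l)"
      using window_less[OF assms(1)] 1 assms by auto
    then have "K x q - (K x p + 1) = 0"
      unfolding window_periodic using dvd zdvd_not_zless[of "K x q - (K x p + 1)" "int (n + 1)"]
      by (smt (verit) dvd_diff_commute)
    then show ?thesis using 1 by simp
  next
    case 2
    then show ?thesis using dvd n_ge by (simp add: zdvd1_eq)
  next
    case 3
    have "K x q < K x p" "K x p < K x (q + int l)"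
      using window_less[OF assms(1)] 3 assms by auto
    then have "K x p + 1 - K x q = int (n + 1)"
      unfolding window_periodic using dvd zdvd_not_zless[of "K x p + 1 - K x q" "int (n + 1)"]
      by linarith
    then show ?thesis using l_le assms by linarith
  qed
qed

lemma fst_to_mono: "fst (to_mono x) = wt affine x"
  using fst_aff_to_mono[OF l_pos, of n "fst x" "snd x"] by (simp add: aff_crystal_def split: prod.split)

lemma snd_to_mono: "x \<in> affine_columns \<Longrightarrow> snd (to_mono x) = window_exp n l (K x)"
  using snd_aff_to_mono[of x n l] l_pos by auto

text \<open>
  Only the entry congruent to \<open>i\<close> moves, so only its box changes. The second index of \<open>A\<close> is one
  more than that of the positive factor of row \<open>i\<close>, in agreement with \<open>q\<^sub>i + 1\<close> in the
  definition of the operator on monomials.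
\<close>

lemma to_mono_f_op:
  assumes "x \<in> affine_columns" "i \<le> n" "f_op affine i x = Some y"
    and "0 \<le> p" "p < int l" "K x p mod int (n + 1) = int i"
  shows "to_mono y = to_mono x - A_mono n i (int l - 1 - 2 * p + K x p)"
proof (rule prod_eqI)
  show "fst (to_mono y) = fst (to_mono x - A_mono n i (int l - 1 - 2 * p + K x p))"
    by (simp add: fst_to_mono wt_f_op[OF assms(1-3)] A_mono_def)
  have y: "y \<in> affine_columns" using f_op_in assms by blast
  define b where "b L q = box n (L q) (int l - 1 - 2 * q)" for L :: "int \<Rightarrow> int" and q
  have eq: "b (K y) q = b (K x) q" if "q \<in> {0..<int l} - {p}" for q
  proof -
    have "K x q mod int (n + 1) \<noteq> int i mod int (n + 1)"
      using window_inj_mod[OF assms(1), of q p] assms that by auto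
    then show ?thesis using window_f_op[OF assms(1-3), of q] by (simp add: raise_def b_def)
  qed
  have "K x p mod int (n + 1) = int i mod int (n + 1)" using assms(2,6) by simp
  then have "raise n (int i) (K x p) = K x p + 1" unfolding raise_def by (rule if_P)
  then have "K y p = K x p + 1" using window_f_op[OF assms(1-3), of p] by simp
  then have "b (K y) p = b (K x) p - snd (A_mono n i (int l - 1 - 2 * p + K x p))"
    using box_Suc[OF assms(6)[symmetric]] by (simp add: b_def)
  then have "(\<Sum>q = 0..<int l. b (K y) q) 
      = (\<Sum>q = 0..<int l. b (K x) q) - snd (A_mono n i (int l - 1 - 2 * p + K x p))"
    using sum.remove[of "{0..<int l}" p "b (K y)"] sum.remove[of "{0..<int l}" p "b (K x)"] assms
      sum.cong[of "{0..<int l} - {p}", OF refl eq] by (simp add: algebra_simps)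
  then show "snd (to_mono y) = snd (to_mono x - A_mono n i (int l - 1 - 2 * p + K x p))"
    by (simp add: snd_to_mono assms(1) y[simplified] window_exp_def b_def snd_to_mono[OF y])
qed

lemma window_before_f_op:
  assumes "x \<in> affine_columns" "i \<le> n" "f_op affine i x = Some y"
  shows "K x p = (if K y p mod int (n + 1) = (int i + 1) mod int (n + 1) then K y p - 1 else K y p)"
proof (cases "K x p mod int (n + 1) = int i mod int (n + 1)")
  case True
  then have "(K x p + 1) mod int (n + 1) = (int i + 1) mod int (n + 1)"
    by (rule mod_add_cong) simp
  then show ?thesis using True window_f_op[OF assms, of p] by (simp only: raise_def) simp
next
  case False
  have "int i + 1 \<notin> range (K x)" using f_op_defined_iff[OF assms(1,2)] assms(3) by auto
  then have "K x p mod int (n + 1) \<noteq> (int i + 1) mod int (n + 1)"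
    using mod_range_window[OF assms(1)] by blast
  then show ?thesis using False window_f_op[OF assms, of p] by (simp add: raise_def)
qed

text \<open>
  A single factor in row \<open>i\<close> sits where the operator on monomials looks for it; two factors are in
  the order that stops both operators. The statement for \<open>e\<^sub>i\<close> follows from that for \<open>f\<^sub>i\<close>
  applied to the preimage.
\<close>

lemma to_mono_morphism:
  assumes "x \<in> affine_columns" "i \<le> n"
  shows "mono_phi i (to_mono x) = phi affine i x" "mono_eps i (to_mono x) = eps affine i x"
    and "mono_f n i (to_mono x) = map_option to_mono (f_op affine i x)"
    and "mono_e n i (to_mono x) = map_option to_mono (e_op affine i x)"
proof -
  have row: "snd (to_mono x) i = (\<lambda>k. 
     (\<Sum>p = 0..<int l. of_bool (int i = K x p mod int (n + 1) \<and> k = int l - 2 - 2 * p + K x p)) -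
     (\<Sum>p = 0..<int l. of_bool (int i = (K x p - 1) mod int (n + 1) \<and> k = int l - 1 - 2 * p + K x p)))"
    unfolding snd_to_mono[OF assms(1)] by (rule ext) (rule window_exp_row)
  note f_def = f_op_defined_iff[OF assms]
  note e_def = e_op_defined_iff[OF assms]
  note [simp] = phi_aff[OF assms] eps_aff[OF assms]
  have "mono_phi i (to_mono x) = phi affine i x \<and> mono_eps i (to_mono x) = eps affine i x \<and>
    mono_f n i (to_mono x) = map_option to_mono (f_op affine i x) \<and> mono_e n i (to_mono x) = map_option to_mono (e_op affine i x)"
  proof (cases "int i \<in> range (K x)"; cases "int i + 1 \<in> range (K x)")
    assume A: "int i \<notin> range (K x)" and B: "int i + 1 \<notin> range (K x)"
    have *: "snd (to_mono x) i = (\<lambda>k. 0)"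
      unfolding row row_pos_none[OF assms(1) A] row_neg_none[OF assms(1) B] by simp
    have ef: "f_op affine i x = None" "e_op affine i x = None" using A B f_def e_def by blast+
    show ?thesis using mono_phi_empty_row[OF *] mono_eps_empty_row[OF *] ef
      by (simp add: mono_f_def mono_e_def)
  next
    assume A: "int i \<in> range (K x)" and B: "int i + 1 \<in> range (K x)"
    obtain p where p: "0 \<le> p" "p < int l" "K x p mod int (n + 1) = int i mod int (n + 1)"
      using window_index[OF A] .
    obtain q where q: "0 \<le> q" "q < int l" "K x q mod int (n + 1) = (int i + 1) mod int (n + 1)"
      using window_index[OF B] .
    have p': "K x p mod int (n + 1) = int i" using p(3) assms(2) by simp
    have "K x q mod int (n + 1) = (K x p + 1) mod int (n + 1)"
      unfolding q(3) by (rule mod_add_cong) (simp_all only: p(3))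
    then have le: "int l - 1 - 2 * q + K x q \<le> int l - 2 - 2 * p + K x p"
      using neighbours_positions[OF assms(1)] p q by blast
    have *: "snd (to_mono x) i = (\<lambda>k. of_bool (k = int l - 2 - 2 * p + K x p) - of_bool (k = int l - 1 - 2 * q + K x q))"
      unfolding row row_pos[OF assms(1) p(1,2) p'] row_neg[OF assms q] ..
    have ef: "f_op affine i x = None" "e_op affine i x = None" using A B f_def e_def by blast+
    show ?thesis using mono_phi_neg_before_pos[OF * le] mono_eps_neg_before_pos[OF * le] ef
      by (simp add: mono_f_def mono_e_def)
  next
    assume A: "int i \<in> range (K x)" and B: "int i + 1 \<notin> range (K x)"
    obtain p where p: "0 \<le> p" "p < int l" "K x p mod int (n + 1) = int i mod int (n + 1)"
      using window_index[OF A] .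
    have p': "K x p mod int (n + 1) = int i" using p(3) assms(2) by simp
    have *: "snd (to_mono x) i = (\<lambda>k. of_bool (k = int l - 2 - 2 * p + K x p))"
      unfolding row row_pos[OF assms(1) p(1,2) p'] row_neg_none[OF assms(1) B] by simp
    have e: "e_op affine i x = None" using A e_def by blast
    obtain y where y: "f_op affine i x = Some y" using A B f_def by blast
    have "mono_f n i (to_mono x) = Some (to_mono x - A_mono n i (int l - 2 - 2 * p + K x p + 1))"
      using mono_phi_single_pos[OF *] mono_q_single_pos[OF *] by (simp add: mono_f_def)
    also have "int l - 2 - 2 * p + K x p + 1 = int l - 1 - 2 * p + K x p" by simp
    also have "to_mono x - A_mono n i (int l - 1 - 2 * p + K x p) = to_mono y"
      by (rule to_mono_f_op[OF assms y p(1,2) p', symmetric])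
    finally show ?thesis using mono_phi_single_pos[OF *] mono_eps_single_pos[OF *] e y
      by (simp add: mono_e_def)
  next
    assume A: "int i \<notin> range (K x)" and B: "int i + 1 \<in> range (K x)"
    obtain q where q: "0 \<le> q" "q < int l" "K x q mod int (n + 1) = (int i + 1) mod int (n + 1)"
      using window_index[OF B] .
    have *: "snd (to_mono x) i = (\<lambda>k. - of_bool (k = int l - 1 - 2 * q + K x q))"
      unfolding row row_pos_none[OF assms(1) A] row_neg[OF assms q] by simp
    have f: "f_op affine i x = None" using A f_def by blast
    obtain y where y: "e_op affine i x = Some y" using A B e_def by blast
    then have y': "y \<in> affine_columns" "f_op affine i y = Some x" using e_op_Some_iff[OF assms] by blast+
    have Ky: "K y q = K x q - 1"
      unfolding window_before_f_op[OF y'(1) assms(2) y'(2), of q] using q(3) by (rule if_P)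
    have "K y q mod int (n + 1) = int i mod int (n + 1)"
      unfolding Ky using q(3) by (simp add: mod_eq_dvd_iff algebra_simps)
    then have "K y q mod int (n + 1) = int i" using assms(2) by simp
    then have "to_mono x = to_mono y - A_mono n i (int l - 1 - 2 * q + K y q)"
      by (rule to_mono_f_op[OF y'(1) assms(2) y'(2) q(1,2)])
    then have "to_mono x + A_mono n i (int l - 1 - 2 * q + K y q) = to_mono y" by simp
    moreover have "int l - 1 - 2 * q + K x q - 1 = int l - 1 - 2 * q + K y q" by (simp add: Ky)
    ultimately have "mono_e n i (to_mono x) = Some (to_mono y)"
      using mono_eps_single_neg[OF *] mono_p_single_neg[OF *] by (simp only: mono_e_def) simp
    then show ?thesis using mono_phi_single_neg[OF *] mono_eps_single_neg[OF *] f y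
      by (simp add: mono_f_def)
  qed
  then show "mono_phi i (to_mono x) = phi affine i x" "mono_eps i (to_mono x) = eps affine i x"
    "mono_f n i (to_mono x) = map_option to_mono (f_op affine i x)"
    "mono_e n i (to_mono x) = map_option to_mono (e_op affine i x)" by blast+
qed

section \<open>Injectivity\<close>

text \<open>
  The sum \<open>\<Sum> k\<^sup>2 u\<^sub>i\<^sub>,\<^sub>k\<close> is additive in monomials, and a box contributes
  \<open>(a + v - 1)\<^sup>2 - (a + v)\<^sup>2\<close>, a linear function of \<open>v\<close>. First moments would not do: each box contributes
  \<open>-1\<close> to \<open>\<Sum> k u\<^sub>i\<^sub>,\<^sub>k\<close>. Restricting \<open>k\<close> to a finite set \<open>S\<close> keeps the sums
  finite.
\<close>

lemma box_second_moment:
  assumes "finite S" "a + v - 1 \<in> S" "a + v \<in> S"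
  shows "(\<Sum>i\<le>n. \<Sum>k\<in>S. k\<^sup>2 * box n v a i k) = 1 - 2 * (a + v)"
proof -
  have one: "(\<Sum>i\<le>n. \<Sum>k\<in>S. k\<^sup>2 * of_bool (int i = w mod int (n + 1) \<and> k = b)) = b\<^sup>2"
    if "b \<in> S" for w b
  proof -
    have "(\<Sum>i\<le>n. \<Sum>k\<in>S. k\<^sup>2 * of_bool (int i = w mod int (n + 1) \<and> k = b)) 
       = (\<Sum>i\<le>n. if i = nat (w mod int (n + 1)) then b\<^sup>2 else 0)"
    proof (rule sum.cong)
      fix i
      have "int i = w mod int (n + 1) \<longleftrightarrow> i = nat (w mod int (n + 1))"
        using pos_mod_sign[of "int (n + 1)" w] by (metis nat_int int_nat_eq of_nat_0_less_iff zero_less_Suc Suc_eq_plus1)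
      then have "(\<Sum>k\<in>S. k\<^sup>2 * of_bool (int i = w mod int (n + 1) \<and> k = b))
          = (\<Sum>k\<in>S. if k = b then (if i = nat (w mod int (n + 1)) then b\<^sup>2 else 0) else 0)"
        by (intro sum.cong) auto
      then show "(\<Sum>k\<in>S. k\<^sup>2 * of_bool (int i = w mod int (n + 1) \<and> k = b)) 
          = (if i = nat (w mod int (n + 1)) then b\<^sup>2 else 0)"
        using that assms(1) by simp
    qed simp
    also have "nat (w mod int (n + 1)) \<le> n" using pos_mod_bound[of "int (n + 1)" w] by linarith
    then have "(\<Sum>i\<le>n. if i = nat (w mod int (n + 1)) then b\<^sup>2 else 0) = b\<^sup>2" by simp
    finally show ?thesis .
  qed
  have "(\<Sum>i\<le>n. \<Sum>k\<in>S. k\<^sup>2 * box n v a i k) = (a + v - 1)\<^sup>2 - (a + v)\<^sup>2"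
    unfolding box_def right_diff_distrib sum_subtractf using one assms by simp
  also have "\<dots> = 1 - 2 * (a + v)" by (simp add: power2_eq_square algebra_simps)
  finally show ?thesis .
qed

lemma window_sum_eq:
  assumes "window_exp n l L = window_exp n l L'"
  shows "(\<Sum>p = 0..<int l. L p) = (\<Sum>p = 0..<int l. L' p)"
proof -
  define pos where "pos L p = int l - 1 - 2 * p + L p" for L :: "int \<Rightarrow> int" and p
  \<comment> \<open>a finite set of second indices that contains the support of both monomials\<close>
  define S where "S = (\<Union>p\<in>{0..<int l}. {pos L p - 1, pos L p, pos L' p - 1, pos L' p})"
  have fin: "finite S" by (simp add: S_def)
  have moment: "(\<Sum>i\<le>n. \<Sum>k\<in>S. k\<^sup>2 * window_exp n l M i k) = (\<Sum>p = 0..<int l. 1 - 2 * pos M p)"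
    if "M = L \<or> M = L'" for M
  proof -
    have "(\<Sum>i\<le>n. \<Sum>k\<in>S. k\<^sup>2 * window_exp n l M i k) 
       = (\<Sum>i\<le>n. \<Sum>p = 0..<int l. \<Sum>k\<in>S. k\<^sup>2 * box n (M p) (int l - 1 - 2 * p) i k)"
      unfolding window_exp_def sum_apply sum_distrib_left by (rule sum.cong[OF refl]) (rule sum.swap)
    also have "\<dots> = (\<Sum>p = 0..<int l. \<Sum>i\<le>n. \<Sum>k\<in>S. k\<^sup>2 * box n (M p) (int l - 1 - 2 * p) i k)"
      by (rule sum.swap)
    also have "\<dots> = (\<Sum>p = 0..<int l. 1 - 2 * pos M p)"
    proof (rule sum.cong)
      fix p assume "p \<in> {0..<int l}"
      then have "pos M p - 1 \<in> S" "pos M p \<in> S" using that unfolding S_def by blast+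
      then show "(\<Sum>i\<le>n. \<Sum>k\<in>S. k\<^sup>2 * box n (M p) (int l - 1 - 2 * p) i k) = 1 - 2 * pos M p"
        unfolding pos_def by (intro box_second_moment fin)
    qed simp
    finally show ?thesis .
  qed
  have "(\<Sum>p = 0..<int l. 1 - 2 * pos L p) = (\<Sum>p = 0..<int l. 1 - 2 * pos L' p)"
    using moment[of L] moment[of L'] assms by simp
  then have "(\<Sum>p = 0..<int l. 1 - 2 * pos L p) - (\<Sum>p = 0..<int l. 1 - 2 * pos L' p) = 0" by simp
  then have "(\<Sum>p = 0..<int l. 2 * (L' p - L p)) = 0"
    unfolding sum_subtractf[symmetric] pos_def by (simp add: algebra_simps)
  then show ?thesis by (simp add: sum_distrib_left[symmetric] sum_subtractf)
qed

text \<open>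
  The exponents determine \<open>\<phi>\<^sub>i - \<epsilon>\<^sub>i\<close>, hence for each \<open>i\<close> the difference of the indicators of
  \<open>i\<close> and \<open>i + 1\<close> in the column. Two columns with the same differences have indicators which differ
  by a constant, and this constant is \<open>0\<close> because neither column is empty.
\<close>

lemma column_eq_of_exponents:
  assumes "x \<in> affine_columns" "y \<in> affine_columns" "snd (to_mono x) = snd (to_mono y)"
  shows "snd x = snd y"
proof -
  \<comment> \<open>the difference of the two indicators; it is constant around the cycle\<close>
  define f where "f i = (of_bool (int i \<in> range (K x)) - of_bool (int i \<in> range (K y)) :: int)" for i
  have eq: "mono_phi i (to_mono x) = mono_phi i (to_mono y)" "mono_eps i (to_mono x) = mono_eps i (to_mono y)" for i
    using assms(3) by (simp_all add: mono_phi_def mono_eps_def phi_upto_def eps_from_def)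
  have diff: "mono_phi i (to_mono z) - mono_eps i (to_mono z) 
      = of_bool (int i \<in> range (K z)) - of_bool (int i + 1 \<in> range (K z))" 
    if "z \<in> affine_columns" "i \<le> n" for z i
    unfolding to_mono_morphism[OF that] phi_aff[OF that] eps_aff[OF that] 
      f_op_defined_iff[OF that] e_op_defined_iff[OF that] by auto
  have step: "f (Suc i) = f i" if "i \<le> n" for i
    using diff[OF assms(1) that] diff[OF assms(2) that] eq[of i] by (simp add: f_def add.commute)
  have const: "f i = f 0" if "i \<le> n + 1" for i
    using that by (induction i) (auto simp: step)
  have pos: "\<exists>i\<le>n. int i \<in> range (K z)" if "z \<in> affine_columns" for z
  proof (intro exI conjI)
    have eq: "int (nat (K z 0 mod int (n + 1))) = K z 0 mod int (n + 1)" by simp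
    show "nat (K z 0 mod int (n + 1)) \<le> n" using pos_mod_bound[of "int (n + 1)" "K z 0"] by linarith
    show "int (nat (K z 0 mod int (n + 1))) \<in> range (K z)"
      unfolding eq using mod_range_window[OF that, of "K z 0 mod int (n + 1)" "K z 0"] by simp
  qed
  have "0 \<le> f 0" "f 0 \<le> 0"
  proof -
    obtain i where "i \<le> n" "int i \<in> range (K x)" using pos[OF assms(1)] by blast
    then show "0 \<le> f 0" using const[of i] by (auto simp: f_def of_bool_def split: if_splits)
    obtain i where "i \<le> n" "int i \<in> range (K y)" using pos[OF assms(2)] by blast
    then show "f 0 \<le> 0" using const[of i] by (auto simp: f_def of_bool_def split: if_splits)
  qed
  then have zero: "f i = 0" if "i \<le> n + 1" for i using const[OF that] by simp
  have range_eq: "int i \<in> range (K x) \<longleftrightarrow> int i \<in> range (K y)" if "i \<le> n + 1" for i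
    using zero[OF that] unfolding f_def
    by (cases "int i \<in> range (K x)"; cases "int i \<in> range (K y)") simp_all
  obtain c T d U where xy: "x = (c, T)" "y = (d, U)" by (cases x; cases y)
  have "i \<in> set T \<longleftrightarrow> i \<in> set U" if "1 \<le> i" "i \<le> n + 1" for i
    using in_set_iff_range[of c T i] in_set_iff_range[of d U i] assms range_eq[of i] that
    unfolding xy by simp
  then have "set T = set U" using assms(1,2) unfolding xy by (auto simp: in_columns_iff)
  then show ?thesis using columns_eqI assms unfolding xy by auto
qed

text \<open>
  The column is known from the rows, and its power of
  \<open>z\<close> from the sum of the window, since a larger power makes every entry smaller. Hence the factor
  \<open>e\<^sup>\<omega>\<close> of an element of the component is determined by its exponents.
\<close>

lemma to_mono_exponents_inj:
  assumes "x \<in> affine_columns" "y \<in> affine_columns" "snd (to_mono x) = snd (to_mono y)"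
  shows "x = y"
proof -
  obtain c d T where xy: "x = (c, T)" "y = (d, T)"
    using column_eq_of_exponents[OF assms] by (cases x; cases y) auto
  have "\<not> c < d" if "(c, T) \<in> affine_columns" "(d, T) \<in> affine_columns" 
    "window_exp n l (K (c, T)) = window_exp n l (K (d, T))" for c d
  proof
    assume "c < d"
    have "K (d, T) p < K (c, T) p" for p
    proof -
      have "K (d, T) p = K (c, T) (p - (d - c))" by (simp add: window_def algebra_simps)
      then show ?thesis using window_less[OF that(1), of "p - (d - c)" p] \<open>c < d\<close> by simp
    qed
    then have "(\<Sum>p = 0..<int l. K (d, T) p) < (\<Sum>p = 0..<int l. K (c, T) p)"
      using l_pos by (intro sum_strict_mono) auto
    then show False using window_sum_eq[OF that(3)] by simp
  qed
  then show ?thesis using assms snd_to_mono unfolding xy by (metis linorder_less_linear)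
qed

section \<open>Connectedness\<close>

lemma col_wt_initial: "col_wt n [1..<Suc k] = fund_weight n k - fund_weight n 0"
  by (induction k) (simp_all add: col_wt_def)

lemma initial_in_columns: "[1..<Suc l] \<in> columns n l"
  using l_le by (auto simp: in_columns_iff simp del: upt_Suc)

lemma to_mono_initial: "to_mono (0, [1..<Suc l]) = start_mono n l"
proof (rule prod_eqI)
  show "fst (to_mono (0, [1..<Suc l])) = fst (start_mono n l)"
    unfolding fst_aff_to_mono[OF l_pos] col_wt_initial
    by (simp add: start_mono_def level_zero_weight_def scale_def zero_fun_def[symmetric])
  let ?Y = "\<lambda>p. Y_exp n p (int l - int p)"
  have "snd (to_mono (0, [1..<Suc l])) = snd (col_mono_base n l [1..<Suc l] 0)"
    by (simp add: aff_to_mono_def col_mono_def tau_def)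
  also have "\<dots> = (\<Sum>p = Suc 0..l. ?Y p - ?Y (p - 1))"
    unfolding col_mono_base_def snd_conv
    by (simp add: box_exp_def del: upt_Suc) (rule sum.cong, auto simp: nth_upt algebra_simps simp del: upt_Suc)
  also have "\<dots> = ?Y l - ?Y 0" by (rule sum_telescope'') simp
  finally show "snd (to_mono (0, [1..<Suc l])) = snd (start_mono n l)"
    by (simp add: start_mono_def)
qed

lemma window_initial: "0 \<le> p \<Longrightarrow> p < int l \<Longrightarrow> K (0, [1..<Suc l]) p = p + 1"
  by (simp add: window_def nth_upt nat_less_iff del: upt_Suc)

lemma window_minus_mono:
  assumes "x \<in> affine_columns" "p \<le> q" shows "K x p - p \<le> K x q - q"
  using assms(2)
proof (induction q rule: int_ge_induct)
  case (step i)
  then show ?case using window_less_Suc[OF assms(1), of i] by simp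
qed simp

text \<open>
  The distance from the window \<open>1, \<dots>, l\<close> of the generating monomial.
\<close>

definition deviation :: "int \<times> nat list \<Rightarrow> nat" where
  "deviation x = (\<Sum>p = 0..<int l. nat \<bar>K x p - (p + 1)\<bar>)"

lemma deviation_less:
  assumes "0 \<le> p" "p < int l" "\<bar>K y p - (p + 1)\<bar> < \<bar>K x p - (p + 1)\<bar>"
    and "\<And>q. 0 \<le> q \<Longrightarrow> q < int l \<Longrightarrow> q \<noteq> p \<Longrightarrow> K y q = K x q"
  shows "deviation y < deviation x"
  unfolding deviation_def
proof (rule sum_strict_mono_ex1)
  show "\<forall>q\<in>{0..<int l}. nat \<bar>K y q - (q + 1)\<bar> \<le> nat \<bar>K x q - (q + 1)\<bar>"
  proof
    fix q assume "q \<in> {0..<int l}"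
    then show "nat \<bar>K y q - (q + 1)\<bar> \<le> nat \<bar>K x q - (q + 1)\<bar>"
      using assms(3) assms(4)[of q] by (cases "q = p") auto
  qed
  show "\<exists>q\<in>{0..<int l}. nat \<bar>K y q - (q + 1)\<bar> < nat \<bar>K x q - (q + 1)\<bar>"
    using assms(1-3) by (intro bexI[of _ p]) auto
qed simp

text \<open>
  A window with a large entry can be moved towards \<open>1, \<dots>, l\<close> by some \<open>e\<^sub>i\<close>. The excess
  \<open>K x q - q\<close> is weakly increasing in \<open>q\<close>, so the first position \<open>q\<close> with maximal excess has
  a gap below its entry; if \<open>q = 0\<close>, the window is a block of \<open>l\<close> consecutive integers, and the gap is
  there because \<open>l < n + 1\<close>.
\<close>

lemma lowering_step:
  assumes "x \<in> affine_columns" "0 \<le> p" "p < int l" "K x p > p + 1"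
  obtains i y where "i \<le> n" "e_op affine i x = Some y" "deviation y < deviation x"
proof -
  define S where "S = {q \<in> {0..<int l}. K x q - q = K x (int l - 1) - (int l - 1)}"
  have "int l - 1 \<in> S" using l_pos by (simp add: S_def)
  then have S: "finite S" "S \<noteq> {}"
    unfolding S_def using finite_atLeastLessThan_int by (blast intro: finite_subset, blast)
  define q where "q = Min S"
  have "q \<in> S" unfolding q_def using S by (rule Min_in)
  then have q: "0 \<le> q" "q < int l" "K x q - q = K x (int l - 1) - (int l - 1)" by (auto simp: S_def)
  have big: "K x q > q + 1" using window_minus_mono[OF assms(1), of p "int l - 1"] assms q by simp
  have gap: "K x (q - 1) < K x q - 1"
  proof (cases "q = 0")
    case True
    have "K x (int l - 1) = K x (-1) + int (n + 1)" using window_periodic[of x "-1"] by simp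
    then show ?thesis using True q l_le l_pos by simp
  next
    case False
    have "q - 1 \<notin> S"
    proof
      assume "q - 1 \<in> S"
      then have "q \<le> q - 1" unfolding q_def using S(1) by (intro Min_le)
      then show False by simp
    qed
    then have "K x (q - 1) - (q - 1) \<noteq> K x q - q" using q False by (auto simp: S_def)
    then show ?thesis using window_minus_mono[OF assms(1), of "q - 1" q] by simp
  qed
  have not_range: "K x q - 1 \<notin> range (K x)"
  proof
    assume "K x q - 1 \<in> range (K x)"
    then obtain p where p: "K x p = K x q - 1" by auto
    then have "p < q" "q - 1 < p" using window_less_iff[OF assms(1), of p q]
        window_less_iff[OF assms(1), of "q - 1" p] gap by simp_all
    then show False by simp
  qed
  define i where "i = nat ((K x q - 1) mod int (n + 1))"
  have i: "int i = (K x q - 1) mod int (n + 1)" by (simp add: i_def)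
  have "i \<le> n" unfolding i_def using pos_mod_bound[of "int (n + 1)" "K x q - 1"] by linarith
  have i1: "(int i + 1) mod int (n + 1) = K x q mod int (n + 1)"
    unfolding i by (simp only: mod_add_left_eq diff_add_cancel)
  have "int i \<notin> range (K x)" using mod_range_window[OF assms(1), of "int i" "K x q - 1"] not_range
    by (simp add: i)
  moreover have "int i + 1 \<in> range (K x)" using mod_range_window[OF assms(1) i1] by blast
  ultimately obtain y where y: "e_op affine i x = Some y"
    using e_op_defined_iff[OF assms(1) \<open>i \<le> n\<close>] by blast
  then have y': "y \<in> affine_columns" "f_op affine i y = Some x" using e_op_Some_iff[OF assms(1) \<open>i \<le> n\<close>] by blast+
  note Ky = window_before_f_op[OF y'(1) \<open>i \<le> n\<close> y'(2), unfolded i1]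
  have "deviation y < deviation x"
  proof (rule deviation_less[OF q(1,2)])
    show "\<bar>K y q - (q + 1)\<bar> < \<bar>K x q - (q + 1)\<bar>" using Ky[of q] big by simp
    show "K y p = K x p" if "0 \<le> p" "p < int l" "p \<noteq> q" for p
      using Ky[of p] window_inj_mod[OF assms(1) that(1,2) q(1,2)] that(3) by auto
  qed
  with that \<open>i \<le> n\<close> y show thesis by blast
qed

text \<open>
  The mirror image: the last position with minimal excess has a gap above its entry.
\<close>

lemma raising_step:
  assumes "x \<in> affine_columns" "0 \<le> p" "p < int l" "K x p < p + 1"
  obtains i y where "i \<le> n" "f_op affine i x = Some y" "deviation y < deviation x"
proof -
  define S where "S = {q \<in> {0..<int l}. K x q - q = K x 0}"
  have "0 \<in> S" using l_pos by (simp add: S_def)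
  then have S: "finite S" "S \<noteq> {}"
    unfolding S_def using finite_atLeastLessThan_int by (blast intro: finite_subset, blast)
  define q where "q = Max S"
  have "q \<in> S" unfolding q_def using S by (rule Max_in)
  then have q: "0 \<le> q" "q < int l" "K x q - q = K x 0" by (auto simp: S_def)
  have small: "K x q < q + 1" using window_minus_mono[OF assms(1), of 0 p] assms q by simp
  have gap: "K x q + 1 < K x (q + 1)"
  proof (cases "q = int l - 1")
    case True
    have "K x (int l) = K x 0 + int (n + 1)" using window_periodic[of x 0] by simp
    then show ?thesis using True q l_le l_pos by simp
  next
    case False
    have "q + 1 \<notin> S"
    proof
      assume "q + 1 \<in> S"
      then have "q + 1 \<le> q" unfolding q_def using S(1) by (intro Max_ge)
      then show False by simp
    qed
    then have "K x (q + 1) - (q + 1) \<noteq> K x q - q" using q False by (auto simp: S_def)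
    then show ?thesis using window_minus_mono[OF assms(1), of q "q + 1"] by simp
  qed
  have not_range: "K x q + 1 \<notin> range (K x)"
  proof
    assume "K x q + 1 \<in> range (K x)"
    then obtain p where p: "K x p = K x q + 1" by auto
    then have "q < p" "p < q + 1" using window_less_iff[OF assms(1), of q p]
        window_less_iff[OF assms(1), of p "q + 1"] gap by simp_all
    then show False by simp
  qed
  define i where "i = nat (K x q mod int (n + 1))"
  have i: "int i = K x q mod int (n + 1)" by (simp add: i_def)
  have "i \<le> n" unfolding i_def using pos_mod_bound[of "int (n + 1)" "K x q"] by linarith
  have i0: "int i mod int (n + 1) = K x q mod int (n + 1)" by (simp add: i)
  have i1: "(int i + 1) mod int (n + 1) = (K x q + 1) mod int (n + 1)"
    unfolding i by (simp only: mod_add_left_eq)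
  have "int i + 1 \<notin> range (K x)" using mod_range_window[OF assms(1) i1] not_range by blast
  moreover have "int i \<in> range (K x)" using mod_range_window[OF assms(1) i0] by blast
  ultimately obtain y where y: "f_op affine i x = Some y"
    using f_op_defined_iff[OF assms(1) \<open>i \<le> n\<close>] by blast
  note Ky = window_f_op[OF assms(1) \<open>i \<le> n\<close> y, unfolded raise_def i0]
  have "deviation y < deviation x"
  proof (rule deviation_less[OF q(1,2)])
    show "\<bar>K y q - (q + 1)\<bar> < \<bar>K x q - (q + 1)\<bar>" using Ky[of q] small by simp
    show "K y p = K x p" if "0 \<le> p" "p < int l" "p \<noteq> q" for p
      using Ky[of p] window_inj_mod[OF assms(1) that(1,2) q(1,2)] that(3) by auto
  qed
  with that \<open>i \<le> n\<close> y show thesis by blast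
qed

text \<open>
  Since \<open>e\<^sub>i\<close> and \<open>f\<^sub>i\<close> are inverse to each other, an element reaches the generator as soon
  as it is reached from it, and induction on the deviation shows that the crystal of columns is
  connected.
\<close>

lemma to_mono_in_component:
  assumes "x \<in> affine_columns" shows "to_mono x \<in> component n (monomial_crystal n s) (start_mono n l)"
  using assms
proof (induction "deviation x" arbitrary: x rule: less_induct)
  case less
  let ?C = "component n (monomial_crystal n s) (start_mono n l)"
  consider p where "0 \<le> p" "p < int l" "K x p > p + 1" | p where "0 \<le> p" "p < int l" "K x p < p + 1" 
    | "\<forall>p. 0 \<le> p \<and> p < int l \<longrightarrow> K x p = p + 1" by (meson linorder_less_linear)
  then show ?case
  proof cases
    case 1
    obtain i y where y: "i \<le> n" "e_op affine i x = Some y" "deviation y < deviation x"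
      using lowering_step[OF less.prems 1] .
    then have y': "y \<in> affine_columns" "f_op affine i y = Some x" using e_op_Some_iff[OF less.prems] by blast+
    then have "f_op (monomial_crystal n s) i (to_mono y) = Some (to_mono x)"
      using to_mono_morphism(3)[OF y'(1) y(1)] by (simp add: monomial_crystal_def)
    then show ?thesis using component.f_step less.hyps y y' by metis
  next
    case 2
    obtain i y where y: "i \<le> n" "f_op affine i x = Some y" "deviation y < deviation x"
      using raising_step[OF less.prems 2] .
    have y': "y \<in> affine_columns" using f_op_in[OF less.prems] y by blast
    then have "e_op affine i y = Some x" using e_op_iff_f_op less.prems y by blast
    then have "e_op (monomial_crystal n s) i (to_mono y) = Some (to_mono x)"
      using to_mono_morphism(4)[OF y' y(1)] by (simp add: monomial_crystal_def)
    then show ?thesis using component.e_step less.hyps y y' by metis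
  next
    case 3
    have init: "(0, [1..<Suc l]) \<in> affine_columns" using initial_in_columns by simp
    have "window_exp n l (K x) = window_exp n l (K (0, [1..<Suc l]))"
      unfolding window_exp_def by (rule sum.cong) (use 3 window_initial in auto)
    then have "x = (0, [1..<Suc l])"
      using to_mono_exponents_inj[OF less.prems init] snd_to_mono[OF less.prems] snd_to_mono[OF init] by simp
    then show ?thesis using to_mono_initial component.base by metis
  qed
qed

lemma component_eq: "component n (monomial_crystal n s) (start_mono n l) = to_mono ` affine_columns"
proof
  show "to_mono ` affine_columns \<subseteq> component n (monomial_crystal n s) (start_mono n l)"
    using to_mono_in_component by blast
  show "component n (monomial_crystal n s) (start_mono n l) \<subseteq> to_mono ` affine_columns"
  proof
    fix m assume "m \<in> component n (monomial_crystal n s) (start_mono n l)"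
    then show "m \<in> to_mono ` affine_columns"
    proof induction
      case base
      then show ?case using to_mono_initial initial_in_columns by (metis SigmaI UNIV_I image_eqI)
    next
      case (e_step m i m')
      then obtain x where x: "x \<in> affine_columns" "m = to_mono x" by blast
      then have "map_option to_mono (e_op affine i x) = Some m'"
        using e_step to_mono_morphism(4)[of x i] by (simp add: monomial_crystal_def)
      then show ?case using e_op_in[OF x(1) e_step(2)] by (auto simp only: map_option_eq_Some)
    next
      case (f_step m i m')
      then obtain x where x: "x \<in> affine_columns" "m = to_mono x" by blast
      then have "map_option to_mono (f_op affine i x) = Some m'"
        using f_step to_mono_morphism(3)[of x i] by (simp add: monomial_crystal_def)
      then show ?case using f_op_in[OF x(1) f_step(2)] by (auto simp only: map_option_eq_Some)
    qed
  qed
qed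

lemma crystal_iso_to_mono: "crystal_iso n affine (M_crystal n s l) to_mono"
proof -
  have carrier: "carrier affine = affine_columns" by (simp add: aff_crystal_def)
  have "inj_on to_mono affine_columns" using to_mono_exponents_inj by (metis inj_onI)
  then have "bij_betw to_mono affine_columns (carrier (M_crystal n s l))"
    by (simp add: bij_betw_def M_crystal_def generated_subcrystal_def component_eq)
  then show ?thesis unfolding crystal_iso_def carrier
    by (simp add: M_crystal_def generated_subcrystal_def monomial_crystal_def fst_to_mono to_mono_morphism)
qed

section \<open>Promotion and rotation\<close>

lemma box_rotate: "box n (v + 1) a i k = rotate_exp n (box n v a) i k"
proof (cases "i \<le> n")
  case False
  then have "int i \<noteq> w mod int (n + 1)" for w
    using pos_mod_bound[of "int (n + 1)" w] by linarith
  then show ?thesis using False by (simp add: box_def rotate_exp_def)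
next
  case True
  have "int i = (w + 1) mod int (n + 1) \<longleftrightarrow> int ((i + n) mod (n + 1)) = w mod int (n + 1)" for w
  proof -
    have "int i = (w + 1) mod int (n + 1) \<longleftrightarrow> int i mod int (n + 1) = (w + 1) mod int (n + 1)"
      using True by simp
    also have "\<dots> \<longleftrightarrow> (int i - 1) mod int (n + 1) = w mod int (n + 1)"
      by (simp add: mod_eq_dvd_iff algebra_simps)
    also have "(int i - 1) mod int (n + 1) = (int i - 1 + int (n + 1)) mod int (n + 1)"
      by (rule mod_add_self2[symmetric])
    also have "\<dots> = int ((i + n) mod (n + 1))" by (simp add: zmod_int)
    finally show ?thesis .
  qed
  from this[of v] this[of "v - 1"] show ?thesis using True
    by (auto simp add: box_def rotate_exp_def simp del: of_nat_add of_nat_Suc)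
qed

lemma window_exp_rotate: "window_exp n l (\<lambda>p. L p + 1) = rotate_exp n (window_exp n l L)"
  by (intro ext) (simp add: window_exp_def sum_apply box_rotate rotate_exp_def)

text \<open>
  Promotion adds one to all entries of the window, which rotates all boxes; injectivity on exponents
  makes the rotated exponents name a single element of the component.
\<close>

lemma to_mono_aff_promotion:
  assumes "x \<in> affine_columns" shows "to_mono (aff_promotion n x) = rotate_mono n s l (to_mono x)"
  unfolding rotate_mono_def
proof (rule the_equality[symmetric])
  have carrier: "carrier (M_crystal n s l) = to_mono ` affine_columns"
    by (simp add: M_crystal_def generated_subcrystal_def component_eq)
  have pr: "aff_promotion n x \<in> affine_columns" using assms by (rule aff_promotion_in)
  have snd_pr: "snd (to_mono (aff_promotion n x)) = rotate_exp n (snd (to_mono x))"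
    unfolding snd_to_mono[OF pr] snd_to_mono[OF assms] window_exp_rotate[symmetric]
    using window_aff_promotion[OF assms] by (intro arg_cong[of _ _ "window_exp n l"] ext)
  then show "to_mono (aff_promotion n x) \<in> carrier (M_crystal n s l) \<and> 
      snd (to_mono (aff_promotion n x)) = rotate_exp n (snd (to_mono x))"
    unfolding carrier using imageI[OF pr] by (rule conjI[rotated])
  fix m assume m: "m \<in> carrier (M_crystal n s l) \<and> snd m = rotate_exp n (snd (to_mono x))"
  then obtain y where y: "y \<in> affine_columns" "m = to_mono y" unfolding carrier by blast
  then have "snd (to_mono y) = snd (to_mono (aff_promotion n x))" using m snd_pr by (simp only:)
  then show "m = to_mono (aff_promotion n x)" using to_mono_exponents_inj[OF y(1) pr] y(2) by (simp only:)
qed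

end

theorem proposition3p17:
  fixes n r l :: nat and s :: "nat \<Rightarrow> nat"
  assumes "n = 2 * r + 1" and "r \<ge> 1" and "1 \<le> l" and "l \<le> r + 1"
    and "parity_function n s"
    and "start_mono n l \<in> carrier (monomial_crystal n s)"
  shows "crystal_iso n (aff_crystal n l) (M_crystal n s l) (aff_to_mono n l) \<and>
         rotate_mono n s l \<in> carrier (M_crystal n s l) \<rightarrow> carrier (M_crystal n s l) \<and>
         (\<forall>x\<in>carrier (aff_crystal n l).
            aff_to_mono n l (aff_promotion n x) = rotate_mono n s l (aff_to_mono n l x))"
proof -
  interpret column_shape n l
    using assms by unfold_locales auto
  have carrier: "carrier affine = affine_columns" "carrier (M_crystal n s l) = to_mono ` affine_columns"
    by (simp_all add: aff_crystal_def M_crystal_def generated_subcrystal_def component_eq)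
  have "rotate_mono n s l \<in> to_mono ` affine_columns \<rightarrow> to_mono ` affine_columns"
  proof
    fix m assume "m \<in> to_mono ` affine_columns"
    then obtain x where "x \<in> affine_columns" "m = to_mono x" by blast
    then show "rotate_mono n s l m \<in> to_mono ` affine_columns"
      using to_mono_aff_promotion[of x s] aff_promotion_in[of x] by (metis imageI)
  qed
  then show ?thesis using crystal_iso_to_mono to_mono_aff_promotion unfolding carrier by blast
qed

end
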